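(* For any integer $\gamma \geq 0$, the operad $\mathsf{Dias}_\gamma$ admits the following presentation. It is generated by $\mathfrak{G}_\gamma := \{\dashv_a, \vdash_a : a \in [\gamma]\}$ (all generators being of arity $2$) and its space of relations is the space induced by the equivalence relation $\leftrightarrow_\gamma$ satisfying $$\dashv_a \circ_1 \vdash_{a'} \;\leftrightarrow_\gamma\; \vdash_{a'} \circ_2 \dashv_a, \qquad a, a' \in [\gamma],$$ $$\dashv_a \circ_1 \dashv_b \;\leftrightarrow_\gamma\; \dashv_a \circ_2 \vdash_b, \qquad a < b \in [\gamma],$$ $$\vdash_a \circ_1 \dashv_b \;\leftrightarrow_\gamma\; \vdash_a \circ_2 \vdash_b, \qquad a < b \in [\gamma],$$ $$\dashv_b \circ_1 \dashv_a \;\leftrightarrow_\gamma\; \dashv_a \circ_2 \dashv_b, \qquad a < b \in [\gamma],$$ $$\vdash_a \circ_1 \vdash_b \;\leftrightarrow_\gamma\; \vdash_b \circ_2 \vdash_a, \qquad a < b \in [\gamma],$$ $$\dashv_d \circ_1 \dashv_d \;\leftrightarrow_\gamma\; \dashv_d \circ_2 \dashv_c \;\leftrightarrow_\gamma\; \dashv_d \circ_2 \vdash_c, \qquad c \leq d \in [\gamma],$$ $$\vdash_d \circ_1 \dashv_c \;\leftrightarrow_\gamma\; \vdash_d \circ_1 \vdash_c \;\leftrightarrow_\gamma\; \vdash_d \circ_2 \vdash_d, \qquad c \leq d \in [\gamma].$$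
   Context: The ground field $\mathbb{K}$ has characteristic zero; $[\gamma] = \{1,\dots,\gamma\}$. Operads are nonsymmetric, described by partial compositions $\circ_i$ and a unit. For a monoid $(\mathcal{M}, \bullet, 1)$, $\mathsf{T}\mathcal{M}$ is the operad whose arity-$n$ component ($n \ge 1$) is the linear span of the words of length $n$ on $\mathcal{M}$, with $u \circ_i v := u_1 \dots u_{i-1}\,(u_i \bullet v_1) \dots (u_i \bullet v_m)\, u_{i+1} \dots u_n$ (for words $u,v$ of lengths $n,m$) and unit the one-letter word $1$. Let $\mathcal{M}_\gamma$ be the monoid on $\{0\} \cup [\gamma]$ with product $\max$. $\mathsf{Dias}_\gamma$ is the suboperad of $\mathsf{T}\mathcal{M}_\gamma$ generated by the words $0a$ and $a0$, $a \in [\gamma]$. $\mathbf{Free}(S)$ is the free nonsymmetric operad on a graded set $S$: its arity-$n$ component has as basis the planar rooted trees with $n$ leaves whose internal nodes of arity $k$ are labeled by elements of $S$ of arity $k$, and $\mathfrak{s} \circ_i \mathfrak{t}$ is the tree obtained by grafting the root of $\mathfrak{t}$ on the $i$th leaf of $\mathfrak{s}$. An element $x \in S$ is identified with the tree having a single internal node labeled by $x$, so $x \circ_i y$ is a tree with two internal nodes. A presentation of an operad $\mathcal{O}$ is a pair $(\mathfrak{G}, \mathfrak{R})$ with $\mathfrak{G}$ a graded set and $\mathfrak{R}$ a subspace of $\mathbf{Free}(\mathfrak{G})$ such that $\mathcal{O} \cong \mathbf{Free}(\mathfrak{G})/\langle\mathfrak{R}\rangle$, with $\langle \mathfrak{R}\rangle$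 the operad ideal generated by $\mathfrak{R}$. The space induced by an equivalence relation $\leftrightarrow$ on trees (of equal arity) is the linear span of all $x - x'$ with $x \leftrightarrow x'$. *)

theory Defs
  imports Complex_Main "HOL-Algebra.Group" "HOL-Library.Poly_Mapping"
begin

section \<open>Nonsymmetric linear operads\<close>

text \<open>
  All operations carry the arities of their arguments, so that carriers of different arities
  may overlap (they all contain the zero vector when elements are formal linear combinations).
  The product \<open>x \<circ>\<^sub>i y\<close> of \<open>x\<close> of arity \<open>n\<close> and \<open>y\<close> of arity \<open>m\<close> is \<open>pcomp \<O> n m i x y\<close>,
  with \<open>i\<close> counted from 1. Arity 0 is allowed in general; it is the zero space in the operads
  \<open>T_operad\<close> below.
\<close>

record ('k, 'a) operad =
  comp :: "nat \<Rightarrow> 'a set"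
  vadd :: "nat \<Rightarrow> 'a \<Rightarrow> 'a \<Rightarrow> 'a"
  vzero :: "nat \<Rightarrow> 'a"
  vscale :: "nat \<Rightarrow> 'k \<Rightarrow> 'a \<Rightarrow> 'a"
  pcomp :: "nat \<Rightarrow> nat \<Rightarrow> nat \<Rightarrow> 'a \<Rightarrow> 'a \<Rightarrow> 'a"
  opunit :: 'a

locale ns_operad =
  fixes \<O> :: "('k::field, 'a) operad"
  assumes comp_group: "\<And>n. comm_group \<lparr>carrier = comp \<O> n, mult = vadd \<O> n, one = vzero \<O> n\<rparr>"
    and vscale_closed: "\<And>n c x. x \<in> comp \<O> n \<Longrightarrow> vscale \<O> n c x \<in> comp \<O> n"
    and vscale_add_right: "\<And>n c x y. x \<in> comp \<O> n \<Longrightarrow> y \<in> comp \<O> n \<Longrightarrow>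
      vscale \<O> n c (vadd \<O> n x y) = vadd \<O> n (vscale \<O> n c x) (vscale \<O> n c y)"
    and vscale_add_left: "\<And>n c d x. x \<in> comp \<O> n \<Longrightarrow>
      vscale \<O> n (c + d) x = vadd \<O> n (vscale \<O> n c x) (vscale \<O> n d x)"
    and vscale_vscale: "\<And>n c d x. x \<in> comp \<O> n \<Longrightarrow>
      vscale \<O> n c (vscale \<O> n d x) = vscale \<O> n (c * d) x"
    and vscale_one: "\<And>n x. x \<in> comp \<O> n \<Longrightarrow> vscale \<O> n 1 x = x"
    and pcomp_closed: "\<And>n m i x y. x \<in> comp \<O> n \<Longrightarrow> y \<in> comp \<O> m \<Longrightarrow> i \<in> {1..n} \<Longrightarrow>
      pcomp \<O> n m i x y \<in> comp \<O> (n + m - 1)"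
    and pcomp_add_left: "\<And>n m i x x' y.
      x \<in> comp \<O> n \<Longrightarrow> x' \<in> comp \<O> n \<Longrightarrow> y \<in> comp \<O> m \<Longrightarrow> i \<in> {1..n} \<Longrightarrow>
      pcomp \<O> n m i (vadd \<O> n x x') y =
        vadd \<O> (n + m - 1) (pcomp \<O> n m i x y) (pcomp \<O> n m i x' y)"
    and pcomp_add_right: "\<And>n m i x y y'.
      x \<in> comp \<O> n \<Longrightarrow> y \<in> comp \<O> m \<Longrightarrow> y' \<in> comp \<O> m \<Longrightarrow> i \<in> {1..n} \<Longrightarrow>
      pcomp \<O> n m i x (vadd \<O> m y y') =
        vadd \<O> (n + m - 1) (pcomp \<O> n m i x y) (pcomp \<O> n m i x y')"
    and pcomp_scale_left: "\<And>n m i c x y. x \<in> comp \<O> n \<Longrightarrow> y \<in> comp \<O> m \<Longrightarrow> i \<in> {1..n} \<Longrightarrow>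
      pcomp \<O> n m i (vscale \<O> n c x) y = vscale \<O> (n + m - 1) c (pcomp \<O> n m i x y)"
    and pcomp_scale_right: "\<And>n m i c x y. x \<in> comp \<O> n \<Longrightarrow> y \<in> comp \<O> m \<Longrightarrow> i \<in> {1..n} \<Longrightarrow>
      pcomp \<O> n m i x (vscale \<O> m c y) = vscale \<O> (n + m - 1) c (pcomp \<O> n m i x y)"
    and opunit_closed: "opunit \<O> \<in> comp \<O> 1"
    and opunit_left: "\<And>n x. x \<in> comp \<O> n \<Longrightarrow> pcomp \<O> 1 n 1 (opunit \<O>) x = x"
    and opunit_right: "\<And>n i x. x \<in> comp \<O> n \<Longrightarrow> i \<in> {1..n} \<Longrightarrow> pcomp \<O> n 1 i x (opunit \<O>) = x"
    and pcomp_sequential: "\<And>n m l i j x y z.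
      x \<in> comp \<O> n \<Longrightarrow> y \<in> comp \<O> m \<Longrightarrow> z \<in> comp \<O> l \<Longrightarrow> i \<in> {1..n} \<Longrightarrow> j \<in> {1..m} \<Longrightarrow>
      pcomp \<O> (n + m - 1) l (i + j - 1) (pcomp \<O> n m i x y) z =
        pcomp \<O> n (m + l - 1) i x (pcomp \<O> m l j y z)"
    and pcomp_parallel: "\<And>n m l i j x y z.
      x \<in> comp \<O> n \<Longrightarrow> y \<in> comp \<O> m \<Longrightarrow> z \<in> comp \<O> l \<Longrightarrow> 1 \<le> i \<Longrightarrow> i < j \<Longrightarrow> j \<le> n \<Longrightarrow>
      pcomp \<O> (n + m - 1) l (j + m - 1) (pcomp \<O> n m i x y) z =
        pcomp \<O> (n + l - 1) m i (pcomp \<O> n l j x z) y"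

definition operad_iso :: "('k, 'a) operad \<Rightarrow> ('k, 'b) operad \<Rightarrow> bool" where
  "operad_iso \<O> P \<longleftrightarrow> (\<exists>\<phi> :: nat \<Rightarrow> 'a \<Rightarrow> 'b.
     (\<forall>n. bij_betw (\<phi> n) (comp \<O> n) (comp P n)) \<and>
     (\<forall>n. \<forall>x\<in>comp \<O> n. \<forall>y\<in>comp \<O> n. \<phi> n (vadd \<O> n x y) = vadd P n (\<phi> n x) (\<phi> n y)) \<and>
     (\<forall>n c. \<forall>x\<in>comp \<O> n. \<phi> n (vscale \<O> n c x) = vscale P n c (\<phi> n x)) \<and>
     (\<forall>n m. \<forall>i\<in>{1..n}. \<forall>x\<in>comp \<O> n. \<forall>y\<in>comp \<O> m.
        \<phi> (n + m - 1) (pcomp \<O> n m i x y) = pcomp P n m i (\<phi> n x) (\<phi> m y)) \<and>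
     \<phi> 1 (opunit \<O>) = opunit P)"

definition graded_subspace :: "('k, 'a) operad \<Rightarrow> (nat \<Rightarrow> 'a set) \<Rightarrow> bool" where
  "graded_subspace \<O> W \<longleftrightarrow> (\<forall>n. W n \<subseteq> comp \<O> n \<and> vzero \<O> n \<in> W n \<and>
     (\<forall>x\<in>W n. \<forall>y\<in>W n. vadd \<O> n x y \<in> W n) \<and>
     (\<forall>c. \<forall>x\<in>W n. vscale \<O> n c x \<in> W n))"

definition suboperad :: "('k, 'a) operad \<Rightarrow> (nat \<Rightarrow> 'a set) \<Rightarrow> bool" where
  "suboperad \<O> P \<longleftrightarrow> graded_subspace \<O> P \<and> opunit \<O> \<in> P 1 \<and>
     (\<forall>n m. \<forall>i\<in>{1..n}. \<forall>x\<in>P n. \<forall>y\<in>P m. pcomp \<O> n m i x y \<in> P (n + m - 1))"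

definition generated_suboperad ::
  "('k, 'a) operad \<Rightarrow> (nat \<Rightarrow> 'a set) \<Rightarrow> ('k, 'a) operad" where
  "generated_suboperad \<O> X =
     \<O>\<lparr>comp := \<lambda>n. \<Inter>{P n | P. suboperad \<O> P \<and> (\<forall>m. X m \<subseteq> P m)}\<rparr>"

definition operad_ideal :: "('k, 'a) operad \<Rightarrow> (nat \<Rightarrow> 'a set) \<Rightarrow> bool" where
  "operad_ideal \<O> I \<longleftrightarrow> graded_subspace \<O> I \<and>
     (\<forall>n m. \<forall>i\<in>{1..n}. \<forall>x\<in>I n. \<forall>y\<in>comp \<O> m. pcomp \<O> n m i x y \<in> I (n + m - 1)) \<and>
     (\<forall>n m. \<forall>i\<in>{1..n}. \<forall>x\<in>comp \<O> n. \<forall>y\<in>I m. pcomp \<O> n m i x y \<in> I (n + m - 1))"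

definition generated_ideal ::
  "('k, 'a) operad \<Rightarrow> (nat \<Rightarrow> 'a set) \<Rightarrow> nat \<Rightarrow> 'a set" where
  "generated_ideal \<O> R n = \<Inter>{I n | I. operad_ideal \<O> I \<and> (\<forall>m. R m \<subseteq> I m)}"

definition vcoset :: "('k, 'a) operad \<Rightarrow> (nat \<Rightarrow> 'a set) \<Rightarrow> nat \<Rightarrow> 'a \<Rightarrow> 'a set" where
  "vcoset \<O> I n x = vadd \<O> n x ` I n"

text \<open>
  The operations on cosets are unions over all representatives; for an operad ideal \<open>I\<close> all
  the cosets in such a union coincide.
\<close>

definition quotient_operad ::
  "('k, 'a) operad \<Rightarrow> (nat \<Rightarrow> 'a set) \<Rightarrow> ('k, 'a set) operad" where
  "quotient_operad \<O> I = \<lparr>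
     comp = \<lambda>n. vcoset \<O> I n ` comp \<O> n,
     vadd = \<lambda>n X Y. \<Union>x\<in>X. \<Union>y\<in>Y. vcoset \<O> I n (vadd \<O> n x y),
     vzero = \<lambda>n. vcoset \<O> I n (vzero \<O> n),
     vscale = \<lambda>n c X. \<Union>x\<in>X. vcoset \<O> I n (vscale \<O> n c x),
     pcomp = \<lambda>n m i X Y. \<Union>x\<in>X. \<Union>y\<in>Y. vcoset \<O> I (n + m - 1) (pcomp \<O> n m i x y),
     opunit = vcoset \<O> I 1 (opunit \<O>)\<rparr>"


section \<open>Operads with a distinguished basis\<close>

definition pm_scale :: "'k::field \<Rightarrow> ('b \<Rightarrow>\<^sub>0 'k) \<Rightarrow> ('b \<Rightarrow>\<^sub>0 'k)" where
  "pm_scale c p = Poly_Mapping.map ((*) c) p"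

lemma lookup_pm_scale: "Poly_Mapping.lookup (pm_scale c p) b = c * Poly_Mapping.lookup p b"
  by (simp add: pm_scale_def Poly_Mapping.map.rep_eq when_def)

interpretation pm: vector_space "pm_scale :: 'k::field \<Rightarrow> ('b \<Rightarrow>\<^sub>0 'k) \<Rightarrow> ('b \<Rightarrow>\<^sub>0 'k)"
  by standard (auto intro!: poly_mapping_eqI simp: lookup_pm_scale lookup_add algebra_simps)

text \<open>
  \<open>linear_operad B c e\<close> has the formal linear combinations of elements of \<open>B n\<close> as arity-\<open>n\<close>
  component; its partial compositions extend \<open>c i u v\<close> bilinearly.
\<close>

definition linear_operad ::
  "(nat \<Rightarrow> 'b set) \<Rightarrow> (nat \<Rightarrow> 'b \<Rightarrow> 'b \<Rightarrow> 'b) \<Rightarrow> 'b \<Rightarrow> ('k::field, 'b \<Rightarrow>\<^sub>0 'k) operad" where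
  "linear_operad B c e = \<lparr>
     comp = \<lambda>n. {p. Poly_Mapping.keys p \<subseteq> B n},
     vadd = \<lambda>n. (+),
     vzero = \<lambda>n. 0,
     vscale = \<lambda>n. pm_scale,
     pcomp = \<lambda>n m i p q. \<Sum>u\<in>Poly_Mapping.keys p. \<Sum>v\<in>Poly_Mapping.keys q.
       Poly_Mapping.single (c i u v) (Poly_Mapping.lookup p u * Poly_Mapping.lookup q v),
     opunit = Poly_Mapping.single e 1\<rparr>"

definition words :: "('m, 'x) monoid_scheme \<Rightarrow> nat \<Rightarrow> 'm list set" where
  "words M n = {w. length w = n \<and> 1 \<le> n \<and> set w \<subseteq> carrier M}"

definition word_comp ::
  "('m, 'x) monoid_scheme \<Rightarrow> nat \<Rightarrow> 'm list \<Rightarrow> 'm list \<Rightarrow> 'm list" where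
  "word_comp M i u v = take (i - 1) u @ map (\<lambda>a. (u ! (i - 1)) \<otimes>\<^bsub>M\<^esub> a) v @ drop i u"

definition T_operad :: "('m, 'x) monoid_scheme \<Rightarrow> ('k::field, 'm list \<Rightarrow>\<^sub>0 'k) operad" where
  "T_operad M = linear_operad (words M) (word_comp M) [\<one>\<^bsub>M\<^esub>]"

text \<open>
  The free operad on a graded set, given by a set \<open>S\<close> and an arity function \<open>ar\<close>.
\<close>

datatype 's tree = Leaf | Node 's "'s tree list"

fun leaves :: "'s tree \<Rightarrow> nat" where
  "leaves Leaf = 1"
| "leaves (Node s ts) = sum_list (map leaves ts)"

fun wf_tree :: "'s set \<Rightarrow> ('s \<Rightarrow> nat) \<Rightarrow> 's tree \<Rightarrow> bool" where
  "wf_tree S ar Leaf \<longleftrightarrow> True"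
| "wf_tree S ar (Node s ts) \<longleftrightarrow> s \<in> S \<and> length ts = ar s \<and> (\<forall>t\<in>set ts. wf_tree S ar t)"

definition trees :: "'s set \<Rightarrow> ('s \<Rightarrow> nat) \<Rightarrow> nat \<Rightarrow> 's tree set" where
  "trees S ar n = {t. wf_tree S ar t \<and> leaves t = n}"

text \<open>\<open>graft i s t\<close> grafts the root of \<open>t\<close> on the \<open>i\<close>th leaf of \<open>s\<close>, from left to right.\<close>

fun graft :: "nat \<Rightarrow> 's tree \<Rightarrow> 's tree \<Rightarrow> 's tree"
  and graft_list :: "nat \<Rightarrow> 's tree list \<Rightarrow> 's tree \<Rightarrow> 's tree list" where
  "graft i Leaf t = (if i = 1 then t else Leaf)"
| "graft i (Node a ss) t = Node a (graft_list i ss t)"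
| "graft_list i [] t = []"
| "graft_list i (s # ss) t =
     (if i \<le> leaves s then graft i s t # ss else s # graft_list (i - leaves s) ss t)"

definition corolla :: "('s \<Rightarrow> nat) \<Rightarrow> 's \<Rightarrow> 's tree" where
  "corolla ar x = Node x (replicate (ar x) Leaf)"

definition free_operad ::
  "'s set \<Rightarrow> ('s \<Rightarrow> nat) \<Rightarrow> ('k::field, 's tree \<Rightarrow>\<^sub>0 'k) operad" where
  "free_operad S ar = linear_operad (trees S ar) graft Leaf"


section \<open>Presentations\<close>

definition is_presentation ::
  "('k::field, 'a) operad \<Rightarrow> 's set \<Rightarrow> ('s \<Rightarrow> nat) \<Rightarrow> (nat \<Rightarrow> ('s tree \<Rightarrow>\<^sub>0 'k) set) \<Rightarrow> bool" where
  "is_presentation \<O> S ar R \<longleftrightarrow>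
     ns_operad \<O> \<and>
     graded_subspace (free_operad S ar) R \<and>
     operad_iso \<O> (quotient_operad (free_operad S ar) (generated_ideal (free_operad S ar) R))"

definition induced_space ::
  "'s set \<Rightarrow> ('s \<Rightarrow> nat) \<Rightarrow> ('s tree \<Rightarrow> 's tree \<Rightarrow> bool) \<Rightarrow> nat \<Rightarrow> ('s tree \<Rightarrow>\<^sub>0 'k::field) set" where
  "induced_space S ar E n = module.span pm_scale
     {Poly_Mapping.single t 1 - Poly_Mapping.single t' 1 | t t'.
        t \<in> trees S ar n \<and> t' \<in> trees S ar n \<and> E t t'}"


section \<open>The pluriassociative operads\<close>

definition max_monoid :: "nat \<Rightarrow> nat monoid" where
  "max_monoid \<gamma> = \<lparr>carrier = {0..\<gamma>}, mult = max, one = 0\<rparr>"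

lemma monoid_max_monoid: "monoid (max_monoid \<gamma>)"
  by (rule monoidI) (auto simp: max_monoid_def)

definition dias_words :: "nat \<Rightarrow> nat \<Rightarrow> (nat list \<Rightarrow>\<^sub>0 'k::field) set" where
  "dias_words \<gamma> n = (if n = 2
     then {Poly_Mapping.single w 1 | w. \<exists>a\<in>{1..\<gamma>}. w = [0, a] \<or> w = [a, 0]} else {})"

definition Dias :: "nat \<Rightarrow> ('k::field, nat list \<Rightarrow>\<^sub>0 'k) operad" where
  "Dias \<gamma> = generated_suboperad (T_operad (max_monoid \<gamma>)) (dias_words \<gamma>)"

datatype dias_gen = Dashv nat | Vdash nat

definition dias_gens :: "nat \<Rightarrow> dias_gen set" where
  "dias_gens \<gamma> = Dashv ` {1..\<gamma>} \<union> Vdash ` {1..\<gamma>}"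

definition dias_ar :: "dias_gen \<Rightarrow> nat" where
  "dias_ar x = 2"

abbreviation gen_comp :: "dias_gen \<Rightarrow> nat \<Rightarrow> dias_gen \<Rightarrow> dias_gen tree" (\<open>(_ \<circ>[_] _)\<close> [71, 0, 71] 70) where
  "x \<circ>[i] y \<equiv> graft i (corolla dias_ar x) (corolla dias_ar y)"

lemma gen_comp_1: "x \<circ>[1] y = Node x [Node y [Leaf, Leaf], Leaf]"
  by (simp add: corolla_def dias_ar_def numeral_2_eq_2)

lemma gen_comp_2: "x \<circ>[2] y = Node x [Leaf, Node y [Leaf, Leaf]]"
  by (simp add: corolla_def dias_ar_def numeral_2_eq_2)

inductive dias_rel :: "nat \<Rightarrow> dias_gen tree \<Rightarrow> dias_gen tree \<Rightarrow> bool" for \<gamma> :: nat where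
  "a \<in> {1..\<gamma>} \<Longrightarrow> a' \<in> {1..\<gamma>} \<Longrightarrow>
     dias_rel \<gamma> (Dashv a \<circ>[1] Vdash a') (Vdash a' \<circ>[2] Dashv a)"
| "a \<in> {1..\<gamma>} \<Longrightarrow> b \<in> {1..\<gamma>} \<Longrightarrow> a < b \<Longrightarrow>
     dias_rel \<gamma> (Dashv a \<circ>[1] Dashv b) (Dashv a \<circ>[2] Vdash b)"
| "a \<in> {1..\<gamma>} \<Longrightarrow> b \<in> {1..\<gamma>} \<Longrightarrow> a < b \<Longrightarrow>
     dias_rel \<gamma> (Vdash a \<circ>[1] Dashv b) (Vdash a \<circ>[2] Vdash b)"
| "a \<in> {1..\<gamma>} \<Longrightarrow> b \<in> {1..\<gamma>} \<Longrightarrow> a < b \<Longrightarrow>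
     dias_rel \<gamma> (Dashv b \<circ>[1] Dashv a) (Dashv a \<circ>[2] Dashv b)"
| "a \<in> {1..\<gamma>} \<Longrightarrow> b \<in> {1..\<gamma>} \<Longrightarrow> a < b \<Longrightarrow>
     dias_rel \<gamma> (Vdash a \<circ>[1] Vdash b) (Vdash b \<circ>[2] Vdash a)"
| "c \<in> {1..\<gamma>} \<Longrightarrow> d \<in> {1..\<gamma>} \<Longrightarrow> c \<le> d \<Longrightarrow>
     dias_rel \<gamma> (Dashv d \<circ>[1] Dashv d) (Dashv d \<circ>[2] Dashv c)"
| "c \<in> {1..\<gamma>} \<Longrightarrow> d \<in> {1..\<gamma>} \<Longrightarrow> c \<le> d \<Longrightarrow>
     dias_rel \<gamma> (Dashv d \<circ>[2] Dashv c) (Dashv d \<circ>[2] Vdash c)"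
| "c \<in> {1..\<gamma>} \<Longrightarrow> d \<in> {1..\<gamma>} \<Longrightarrow> c \<le> d \<Longrightarrow>
     dias_rel \<gamma> (Vdash d \<circ>[1] Dashv c) (Vdash d \<circ>[1] Vdash c)"
| "c \<in> {1..\<gamma>} \<Longrightarrow> d \<in> {1..\<gamma>} \<Longrightarrow> c \<le> d \<Longrightarrow>
     dias_rel \<gamma> (Vdash d \<circ>[1] Vdash c) (Vdash d \<circ>[2] Vdash d)"

text \<open>The equivalence relation is the least one containing the listed pairs.\<close>

definition dias_equiv :: "nat \<Rightarrow> dias_gen tree \<Rightarrow> dias_gen tree \<Rightarrow> bool" where
  "dias_equiv \<gamma> = equivclp (dias_rel \<gamma>)"

end

theory Submission
  imports Defs
begin

text \<open>
  Both operads have bases on which partial composition is defined, so everything happens on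
  basis elements. Evaluating a tree by reading each generator as a word of length 2 is compatible
  with grafting and constant on the relations, so the ideal of relations lies in the kernel of the
  linearized evaluation. This kernel is spanned by the differences of trees with the same word;
  hence it remains to see that such trees are congruent. Pushing the root over the right, resp.
  left, subtree by means of the relations gives, writing \<open>w\<close> for the word of that subtree,
  \<open>-|\<^sub>a(s, t) \<equiv> ((s -| c\<^sub>1) -| \<dots>) -| c\<^sub>m\<close> and
  \<open>|-\<^sub>a(s, t) \<equiv> c\<^sub>1 |- (\<dots> |- (c\<^sub>m |- t))\<close>, where \<open>c\<^sub>i = max a w\<^sub>i\<close> and every other
  argument is a leaf. So each tree is congruent to a comb that can be read off its word \<open>u 0 v\<close>:
  the letters of \<open>v\<close> are attached on the right of a leaf, then those of \<open>u\<close> on the left.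
\<close>

section \<open>Linear extension\<close>

abbreviation bvec :: "'b \<Rightarrow> ('b \<Rightarrow>\<^sub>0 'k::field)" where
  "bvec b \<equiv> Poly_Mapping.single b 1"

definition supported :: "'b set \<Rightarrow> ('b \<Rightarrow>\<^sub>0 'k::field) set" where
  "supported S = {p. Poly_Mapping.keys p \<subseteq> S}"

lemma pm_scale_single: "pm_scale c (Poly_Mapping.single b d) = Poly_Mapping.single b (c * d)"
  by (rule poly_mapping_eqI) (simp add: lookup_pm_scale lookup_single when_def)

lemma keys_pm_scale: "Poly_Mapping.keys (pm_scale c p) \<subseteq> Poly_Mapping.keys p"
  by (auto simp: in_keys_iff lookup_pm_scale)

lemma subspace_supported: "pm.subspace (supported S)"
  unfolding pm.subspace_def supported_def using keys_add keys_pm_scale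
  by (fastforce dest!: subsetD)

lemma supported_intros [simp, intro]:
  "0 \<in> supported S"
  "u \<in> S \<Longrightarrow> bvec u \<in> supported S"
  "p \<in> supported S \<Longrightarrow> q \<in> supported S \<Longrightarrow> p + q \<in> supported S"
  "p \<in> supported S \<Longrightarrow> q \<in> supported S \<Longrightarrow> p - q \<in> supported S"
  "p \<in> supported S \<Longrightarrow> - p \<in> supported S"
  "p \<in> supported S \<Longrightarrow> pm_scale a p \<in> supported S"
  using pm.subspace_0[OF subspace_supported] pm.subspace_add[OF subspace_supported]
    pm.subspace_diff[OF subspace_supported] pm.subspace_neg[OF subspace_supported]
    pm.subspace_scale[OF subspace_supported]
  by (simp_all add: supported_def)

lemma pm_decompose: "p = (\<Sum>u\<in>Poly_Mapping.keys p. pm_scale (Poly_Mapping.lookup p u) (bvec u))"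
  by (rule poly_mapping_eqI)
    (simp add: pm_scale_single lookup_sum lookup_single when_def in_keys_iff)

text \<open>Reduces linear statements to basis vectors. The steps for sums and multiples carry no
  support condition: the properties proved this way are preserved by arbitrary linear
  combinations.\<close>

lemma supported_induct [consumes 1, case_names zero single add scale]:
  assumes "p \<in> supported S"
    and "P 0"
    and "\<And>u. u \<in> S \<Longrightarrow> P (bvec u)"
    and "\<And>p q. P p \<Longrightarrow> P q \<Longrightarrow> P (p + q)"
    and "\<And>c p. P p \<Longrightarrow> P (pm_scale c p)"
  shows "P p"
proof -
  have "P (\<Sum>u\<in>A. pm_scale (Poly_Mapping.lookup p u) (bvec u))"
    if "finite A" "A \<subseteq> S" for A
    using that by (induction A) (auto intro: assms)
  from this[of "Poly_Mapping.keys p"] assms(1) show ?thesis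
    using pm_decompose[of p] by (simp add: supported_def)
qed

definition lin_ext :: "('b \<Rightarrow> ('c \<Rightarrow>\<^sub>0 'k::field)) \<Rightarrow> ('b \<Rightarrow>\<^sub>0 'k) \<Rightarrow> ('c \<Rightarrow>\<^sub>0 'k)" where
  "lin_ext g p = (\<Sum>u\<in>Poly_Mapping.keys p. pm_scale (Poly_Mapping.lookup p u) (g u))"

text \<open>Cancellation may remove keys from a sum, and scaling by 0 removes all of them. Linearity
  is therefore checked by summing over one finite index set that contains all keys involved.\<close>

lemma lin_ext_superset:
  assumes "finite A" "Poly_Mapping.keys p \<subseteq> A"
  shows "lin_ext g p = (\<Sum>u\<in>A. pm_scale (Poly_Mapping.lookup p u) (g u))"
  unfolding lin_ext_def using assms
  by (intro sum.mono_neutral_left) (auto simp: in_keys_iff)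

lemma lin_ext_zero [simp]: "lin_ext g 0 = 0"
  by (simp add: lin_ext_def)

lemma lin_ext_add [simp]: "lin_ext g (p + q) = lin_ext g p + lin_ext g q"
proof -
  let ?A = "Poly_Mapping.keys p \<union> Poly_Mapping.keys q"
  have "Poly_Mapping.keys (p + q) \<subseteq> ?A"
    by (rule keys_add)
  then show ?thesis
    by (simp add: lin_ext_superset[of ?A] lookup_add pm.scale_left_distrib sum.distrib)
qed

lemma lin_ext_scale [simp]: "lin_ext g (pm_scale c p) = pm_scale c (lin_ext g p)"
  unfolding lin_ext_superset[OF finite_keys keys_pm_scale[of c p]] lin_ext_def[of g p]
  by (simp add: lookup_pm_scale pm.scale_sum_right)

lemma lin_ext_bvec [simp]: "lin_ext g (bvec u) = g u"
  by (simp add: lin_ext_def)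

lemma lin_ext_diff [simp]: "lin_ext g (p - q) = lin_ext g p - lin_ext g q"
proof -
  have "lin_ext g (p - q) + lin_ext g q = lin_ext g p"
    by (simp flip: lin_ext_add)
  then show ?thesis by (simp add: eq_diff_eq)
qed

text \<open>Linearity in the function, here and in the next three lemmas, is what makes
  \<open>bilin\<close> below linear in its second argument, which sits inside the function being
  extended.\<close>

lemma lin_ext_fun_add [simp]: "lin_ext (\<lambda>u. g u + h u) p = lin_ext g p + lin_ext h p"
  by (simp add: lin_ext_def pm.scale_right_distrib sum.distrib)

lemma lin_ext_fun_diff [simp]: "lin_ext (\<lambda>u. g u - h u) p = lin_ext g p - lin_ext h p"
  by (simp add: lin_ext_def pm.scale_right_diff_distrib sum_subtractf)

lemma lin_ext_fun_scale [simp]: "lin_ext (\<lambda>u. pm_scale c (g u)) p = pm_scale c (lin_ext g p)"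
  by (simp add: lin_ext_def pm.scale_sum_right mult.commute)

lemma lin_ext_fun_zero [simp]: "lin_ext (\<lambda>u. 0) p = 0"
  by (simp add: lin_ext_def)

abbreviation push :: "('b \<Rightarrow> 'c) \<Rightarrow> ('b \<Rightarrow>\<^sub>0 'k::field) \<Rightarrow> ('c \<Rightarrow>\<^sub>0 'k)" where
  "push f \<equiv> lin_ext (\<lambda>u. bvec (f u))"

lemma push_supported:
  assumes "p \<in> supported S" "f ` S \<subseteq> S'"
  shows "push f p \<in> supported S'"
  using assms by (induction rule: supported_induct) auto

text \<open>A preimage is the image of \<open>q\<close> under the linearization of a section of
  \<open>f\<close>.\<close>

lemma push_surj:
  assumes "q \<in> supported S'" "S' \<subseteq> f ` S"
  obtains p where "p \<in> supported S" "push f p = q"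
proof
  have inv: "f (inv_into S f v) = v" "inv_into S f v \<in> S" if "v \<in> S'" for v
    using that assms(2) by (auto intro: f_inv_into_f inv_into_into)
  show "push (inv_into S f) q \<in> supported S"
    using assms inv by (intro push_supported[where S = S']) auto
  show "push f (push (inv_into S f) q) = q"
    using assms(1) by (induction rule: supported_induct) (simp_all add: inv)
qed


section \<open>Operads given on a basis\<close>

text \<open>The double sum in \<open>linear_operad\<close>, written as an iterated linear extension
  so that bilinearity follows by simplification.\<close>

definition bilin :: "(nat \<Rightarrow> 'b \<Rightarrow> 'b \<Rightarrow> 'b) \<Rightarrow> nat \<Rightarrow> ('b \<Rightarrow>\<^sub>0 'k::field) \<Rightarrow> ('b \<Rightarrow>\<^sub>0 'k) \<Rightarrow> ('b \<Rightarrow>\<^sub>0 'k)"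
  where "bilin c i p q = lin_ext (\<lambda>u. push (c i u) q) p"

lemma linear_operad_simps [simp]:
  "comp (linear_operad B c e) n = supported (B n)"
  "vadd (linear_operad B c e) n = (+)"
  "vzero (linear_operad B c e) n = 0"
  "vscale (linear_operad B c e) n = pm_scale"
  "opunit (linear_operad B c e) = bvec e"
  by (simp_all add: linear_operad_def supported_def)

lemma linear_operad_pcomp [simp]: "pcomp (linear_operad B c e) n m i = bilin c i"
  by (intro ext)
    (simp add: linear_operad_def bilin_def lin_ext_def pm_scale_single pm.scale_sum_right)

lemma bilin_simps [simp]:
  "bilin c i 0 q = 0"
  "bilin c i p 0 = 0"
  "bilin c i (p + p') q = bilin c i p q + bilin c i p' q"
  "bilin c i p (q + q') = bilin c i p q + bilin c i p q'"
  "bilin c i (p - p') q = bilin c i p q - bilin c i p' q"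
  "bilin c i p (q - q') = bilin c i p q - bilin c i p q'"
  "bilin c i (pm_scale a p) q = pm_scale a (bilin c i p q)"
  "bilin c i p (pm_scale a q) = pm_scale a (bilin c i p q)"
  "bilin c i (bvec u) (bvec v) = bvec (c i u v)"
  by (simp_all add: bilin_def)

lemma bilin_supported:
  assumes "p \<in> supported S" "q \<in> supported S'"
    and closed: "\<And>u v. u \<in> S \<Longrightarrow> v \<in> S' \<Longrightarrow> c i u v \<in> S''"
  shows "bilin c i p q \<in> supported S''"
  using assms(1)
proof (induction rule: supported_induct)
  case (single u)
  from assms(2) show ?case
    by (induction rule: supported_induct) (use single closed in auto)
qed auto

text \<open>Intended for the two associativity axioms, whose sides are trilinear in the three operad
  elements. Linearity is demanded for all vectors, whatever their support, because
  \<open>bilin\<close> is linear on all of them.\<close>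

lemma trilinear_eqI:
  assumes "x \<in> supported S" "y \<in> supported S'" "z \<in> supported S''"
    and basis: "\<And>u v w. u \<in> S \<Longrightarrow> v \<in> S' \<Longrightarrow> w \<in> S'' \<Longrightarrow>
      F (bvec u) (bvec v) (bvec w) = G (bvec u) (bvec v) (bvec w)"
    and F: "\<And>v w. F 0 v w = 0" "\<And>u w. F u 0 w = 0" "\<And>u v. F u v 0 = 0"
      "\<And>u u' v w. F (u + u') v w = F u v w + F u' v w"
      "\<And>u v v' w. F u (v + v') w = F u v w + F u v' w"
      "\<And>u v w w'. F u v (w + w') = F u v w + F u v w'"
      "\<And>a u v w. F (pm_scale a u) v w = pm_scale a (F u v w)"
      "\<And>a u v w. F u (pm_scale a v) w = pm_scale a (F u v w)"
      "\<And>a u v w. F u v (pm_scale a w) = pm_scale a (F u v w)"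
    and G: "\<And>v w. G 0 v w = 0" "\<And>u w. G u 0 w = 0" "\<And>u v. G u v 0 = 0"
      "\<And>u u' v w. G (u + u') v w = G u v w + G u' v w"
      "\<And>u v v' w. G u (v + v') w = G u v w + G u v' w"
      "\<And>u v w w'. G u v (w + w') = G u v w + G u v w'"
      "\<And>a u v w. G (pm_scale a u) v w = pm_scale a (G u v w)"
      "\<And>a u v w. G u (pm_scale a v) w = pm_scale a (G u v w)"
      "\<And>a u v w. G u v (pm_scale a w) = pm_scale a (G u v w)"
  shows "F x y z = (G x y z :: 'c \<Rightarrow>\<^sub>0 'k::field)"
  using assms(1)
proof (induction rule: supported_induct)
  case (single u)
  from assms(2) show ?case
  proof (induction rule: supported_induct)
    case v: (single v)
    from assms(3) show ?case
      by (induction rule: supported_induct) (simp_all add: F G basis single v)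
  qed (simp_all add: F G)
qed (simp_all add: F G)

text \<open>These are the axioms of a nonsymmetric operad in sets; linearizing one gives a linear
  operad.\<close>

locale basis_operad =
  fixes B :: "nat \<Rightarrow> 'b set" and c :: "nat \<Rightarrow> 'b \<Rightarrow> 'b \<Rightarrow> 'b" and e :: 'b
  assumes closed: "\<And>n m i u v. u \<in> B n \<Longrightarrow> v \<in> B m \<Longrightarrow> i \<in> {1..n} \<Longrightarrow> c i u v \<in> B (n + m - 1)"
    and unit_closed: "e \<in> B 1"
    and unit_left: "\<And>n u. u \<in> B n \<Longrightarrow> c 1 e u = u"
    and unit_right: "\<And>n i u. u \<in> B n \<Longrightarrow> i \<in> {1..n} \<Longrightarrow> c i u e = u"
    and sequential: "\<And>n m l i j u v w.
      u \<in> B n \<Longrightarrow> v \<in> B m \<Longrightarrow> w \<in> B l \<Longrightarrow> i \<in> {1..n} \<Longrightarrow> j \<in> {1..m} \<Longrightarrow>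
      c (i + j - 1) (c i u v) w = c i u (c j v w)"
    and parallel: "\<And>n m l i j u v w.
      u \<in> B n \<Longrightarrow> v \<in> B m \<Longrightarrow> w \<in> B l \<Longrightarrow> 1 \<le> i \<Longrightarrow> i < j \<Longrightarrow> j \<le> n \<Longrightarrow>
      c (j + m - 1) (c i u v) w = c i (c j u w) v"
begin

lemma ns_operad_linear_operad: "ns_operad (linear_operad B c e :: ('k::field, 'b \<Rightarrow>\<^sub>0 'k) operad)"
proof (rule ns_operad.intro)
  fix n
  show "comm_group \<lparr>carrier = comp (linear_operad B c e) n, mult = vadd (linear_operad B c e) n,
      one = vzero (linear_operad B c e :: ('k, 'b \<Rightarrow>\<^sub>0 'k) operad) n\<rparr>"
  proof (rule comm_groupI, goal_cases)
    \<comment> \<open>This goal is the existence of additive inverses.\<close>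
    case (6 x)
    then show ?case by (intro bexI[of _ "- x"]) simp_all
  qed (simp_all add: add_ac)
next
  fix n m l i j and x y z :: "'b \<Rightarrow>\<^sub>0 'k"
  assume "x \<in> comp (linear_operad B c e) n" "y \<in> comp (linear_operad B c e) m"
    "z \<in> comp (linear_operad B c e) l" "i \<in> {1..n}" "j \<in> {1..m}"
  then have "bilin c (i + j - 1) (bilin c i x y) z = bilin c i x (bilin c j y z)"
    by (intro trilinear_eqI[of x "B n" y "B m" z "B l"
          "\<lambda>x y z. bilin c (i + j - 1) (bilin c i x y) z"
          "\<lambda>x y z. bilin c i x (bilin c j y z)"])
      (simp_all add: sequential pm.scale_right_distrib del: One_nat_def)
  then show "pcomp (linear_operad B c e) (n + m - 1) l (i + j - 1)
      (pcomp (linear_operad B c e) n m i x y) z =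
    pcomp (linear_operad B c e) n (m + l - 1) i x (pcomp (linear_operad B c e) m l j y z)"
    by simp
next
  fix n m l i j and x y z :: "'b \<Rightarrow>\<^sub>0 'k"
  assume "x \<in> comp (linear_operad B c e) n" "y \<in> comp (linear_operad B c e) m"
    "z \<in> comp (linear_operad B c e) l" "1 \<le> i" "i < j" "j \<le> n"
  then have "bilin c (j + m - 1) (bilin c i x y) z = bilin c i (bilin c j x z) y"
    by (intro trilinear_eqI[of x "B n" y "B m" z "B l"
          "\<lambda>x y z. bilin c (j + m - 1) (bilin c i x y) z"
          "\<lambda>x y z. bilin c i (bilin c j x z) y"])
      (simp_all add: parallel pm.scale_right_distrib del: One_nat_def)
  then show "pcomp (linear_operad B c e) (n + m - 1) l (j + m - 1)
      (pcomp (linear_operad B c e) n m i x y) z =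
    pcomp (linear_operad B c e) (n + l - 1) m i (pcomp (linear_operad B c e) n l j x z) y"
    by simp
next
  fix n and x :: "'b \<Rightarrow>\<^sub>0 'k"
  assume "x \<in> comp (linear_operad B c e) n"
  then have "x \<in> supported (B n)" by simp
  then have "bilin c 1 (bvec e) x = x"
    by (induction rule: supported_induct) (simp_all add: unit_left del: One_nat_def)
  then show "pcomp (linear_operad B c e) 1 n 1 (opunit (linear_operad B c e)) x = x"
    by simp
next
  fix n i and x :: "'b \<Rightarrow>\<^sub>0 'k"
  assume "x \<in> comp (linear_operad B c e) n" and i: "i \<in> {1..n}"
  then have "x \<in> supported (B n)" by simp
  then have "bilin c i x (bvec e) = x"
    by (induction rule: supported_induct) (simp_all add: unit_right[OF _ i])
  then show "pcomp (linear_operad B c e) n 1 i x (opunit (linear_operad B c e)) = x"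
    by simp
next
  fix n m i and x y :: "'b \<Rightarrow>\<^sub>0 'k"
  assume "x \<in> comp (linear_operad B c e) n" "y \<in> comp (linear_operad B c e) m" "i \<in> {1..n}"
  then show "pcomp (linear_operad B c e) n m i x y \<in> comp (linear_operad B c e) (n + m - 1)"
    using bilin_supported[of x "B n" y "B m"] closed by simp
next
  fix n and a :: 'k and x :: "'b \<Rightarrow>\<^sub>0 'k"
  assume "x \<in> comp (linear_operad B c e) n"
  then show "vscale (linear_operad B c e) n a x \<in> comp (linear_operad B c e) n"
    by simp
qed (use unit_closed in \<open>simp_all add: pm.scale_right_distrib pm.scale_left_distrib\<close>)

end

section \<open>First isomorphism theorem for a surjective morphism given on bases\<close>

locale basis_surjection =
  fixes B :: "nat \<Rightarrow> 'b set" and c :: "nat \<Rightarrow> 'b \<Rightarrow> 'b \<Rightarrow> 'b" and e :: 'b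
    and B' :: "nat \<Rightarrow> 'd set" and c' :: "nat \<Rightarrow> 'd \<Rightarrow> 'd \<Rightarrow> 'd" and f :: "'b \<Rightarrow> 'd"
  assumes closed: "\<And>n m i u v. u \<in> B n \<Longrightarrow> v \<in> B m \<Longrightarrow> i \<in> {1..n} \<Longrightarrow> c i u v \<in> B (n + m - 1)"
    and unit_closed: "e \<in> B 1"
    and image: "\<And>n. B' n = f ` B n"
    and hom: "\<And>n m i u v. u \<in> B n \<Longrightarrow> v \<in> B m \<Longrightarrow> i \<in> {1..n} \<Longrightarrow> f (c i u v) = c' i (f u) (f v)"
begin

definition kernel :: "nat \<Rightarrow> ('b \<Rightarrow>\<^sub>0 'k::field) set" where
  "kernel n = {p \<in> supported (B n). push f p = 0}"

text \<open>Fibers of the linearized morphism are the cosets of its kernel. Sending \<open>q\<close>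
  to its fiber is the isomorphism onto the quotient, in the direction that \<open>operad_iso\<close>
  is used in \<open>is_presentation\<close>.\<close>

definition fiber :: "nat \<Rightarrow> ('d \<Rightarrow>\<^sub>0 'k::field) \<Rightarrow> ('b \<Rightarrow>\<^sub>0 'k) set" where
  "fiber n q = {p \<in> supported (B n). push f p = q}"

lemma push_bilin:
  assumes "x \<in> supported (B n)" "y \<in> supported (B m)" "i \<in> {1..n}"
  shows "push f (bilin c i x y) = bilin c' i (push f x) (push f y)"
  using assms(1)
proof (induction rule: supported_induct)
  case (single u)
  from assms(2) show ?case
    by (induction rule: supported_induct) (simp_all add: hom[OF single _ assms(3)])
qed simp_all

lemma bilin_closed:
  assumes "x \<in> supported (B n)" "y \<in> supported (B m)" "i \<in> {1..n}"
  shows "bilin c i x y \<in> supported (B (n + m - 1))"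
  using assms closed by (intro bilin_supported[of x "B n" y "B m"]) auto

lemma graded_subspace_iff:
  "graded_subspace (linear_operad B c e) W \<longleftrightarrow> (\<forall>n. W n \<subseteq> supported (B n) \<and> pm.subspace (W n))"
  by (auto simp: graded_subspace_def pm.subspace_def)

text \<open>By \<open>push_bilin\<close> the linearization commutes with composition, and a
  composition with a zero argument vanishes.\<close>

lemma operad_ideal_kernel: "operad_ideal (linear_operad B c e) kernel"
  unfolding operad_ideal_def graded_subspace_iff
  by (auto simp: kernel_def pm.subspace_def push_bilin bilin_closed simp del: One_nat_def)

lemma vcoset_kernel:
  assumes "x \<in> supported (B n)"
  shows "vcoset (linear_operad B c e) kernel n x = fiber n (push f x)"
proof -
  have "y \<in> (+) x ` kernel n" if "y \<in> fiber n (push f x)" for y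
  proof
    show "y - x \<in> kernel n"
      using that assms
      by (simp add: kernel_def fiber_def)
  qed simp
  then show ?thesis
    using assms
    by (auto simp: vcoset_def kernel_def fiber_def)
qed

lemma fiber_nonempty:
  assumes "q \<in> supported (B' n)"
  obtains p where "p \<in> supported (B n)" "push f p = q"
  using push_surj[OF assms] image by (metis order_refl)

lemma operad_iso_quotient_kernel:
  "operad_iso (linear_operad B' c' (f e) :: ('k::field, _) operad)
     (quotient_operad (linear_operad B c e) kernel)"
  (is "operad_iso ?O (quotient_operad ?F _)")
proof -
  have fiberI: "p \<in> fiber n (push f p)" if "p \<in> supported (B n)" for n and p :: "'b \<Rightarrow>\<^sub>0 'k"
    using that by (simp add: fiber_def)
  have fiberD: "p \<in> supported (B n)" "push f p = q" if "p \<in> fiber n q"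
    for n q and p :: "'b \<Rightarrow>\<^sub>0 'k"
    using that by (simp_all add: fiber_def)
  have ne: "fiber n q \<noteq> {}" if "q \<in> supported (B' n)" for n and q :: "'d \<Rightarrow>\<^sub>0 'k"
    using fiber_nonempty[OF that] fiberI by blast
  have image_supported: "push f p \<in> supported (B' n)" if "p \<in> supported (B n)"
    for n and p :: "'b \<Rightarrow>\<^sub>0 'k"
    using push_supported[OF that, of f "B' n"] image by blast
  have bij: "bij_betw (fiber n) (comp ?O n) (comp (quotient_operad ?F kernel) n)" for n
  proof (rule bij_betw_imageI)
    show "inj_on (fiber n) (comp ?O n)"
    proof (rule inj_onI)
      fix q q' assume "q \<in> comp ?O n" "q' \<in> comp ?O n" and eq: "fiber n q = fiber n q'"
      then obtain p where "p \<in> fiber n q" using ne by fastforce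
      with eq show "q = q'" by (metis fiberD(2))
    qed
    have "fiber n ` supported (B' n) =
        (\<lambda>x. fiber n (push f x)) ` (supported (B n) :: ('b \<Rightarrow>\<^sub>0 'k) set)" (is "?L = ?R")
    proof
      show "?L \<subseteq> ?R"
      proof (rule image_subsetI)
        fix q :: "'d \<Rightarrow>\<^sub>0 'k" assume "q \<in> supported (B' n)"
        then obtain p where "p \<in> supported (B n)" "push f p = q"
          using fiber_nonempty by blast
        then show "fiber n q \<in> ?R" by blast
      qed
    qed (use image_supported in blast)
    also have "\<dots> = comp (quotient_operad ?F kernel) n"
      by (simp add: quotient_operad_def vcoset_kernel)
    finally show "fiber n ` comp ?O n = comp (quotient_operad ?F kernel) n"
      by simp
  qed
  \<comment> \<open>Here and in the next two claims, all cosets in the union are one and the same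
    fiber, and the index sets are nonempty by surjectivity, so the union collapses to that
    fiber.\<close>
  have add: "fiber n (q + q') = (\<Union>x\<in>fiber n q. \<Union>y\<in>fiber n q'. vcoset ?F kernel n (x + y))"
    if "q \<in> supported (B' n)" "q' \<in> supported (B' n)" for n and q q' :: "'d \<Rightarrow>\<^sub>0 'k"
  proof -
    have "vcoset ?F kernel n (x + y) = fiber n (q + q')" if "x \<in> fiber n q" "y \<in> fiber n q'" for x y
      using fiberD[OF that(1)] fiberD[OF that(2)]
      by (simp add: vcoset_kernel)
    then show ?thesis using ne[OF that(1)] ne[OF that(2)] by simp
  qed
  have scale: "fiber n (pm_scale a q) = (\<Union>x\<in>fiber n q. vcoset ?F kernel n (pm_scale a x))"
    if "q \<in> supported (B' n)" for n a and q :: "'d \<Rightarrow>\<^sub>0 'k"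
  proof -
    have "vcoset ?F kernel n (pm_scale a x) = fiber n (pm_scale a q)" if "x \<in> fiber n q" for x
      using fiberD[OF that]
      by (simp add: vcoset_kernel)
    then show ?thesis using ne[OF that] by simp
  qed
  have pcomp: "fiber (n + m - 1) (bilin c' i q q') =
      (\<Union>x\<in>fiber n q. \<Union>y\<in>fiber m q'. vcoset ?F kernel (n + m - 1) (bilin c i x y))"
    if "q \<in> supported (B' n)" "q' \<in> supported (B' m)" and i: "i \<in> {1..n}"
    for n m i and q q' :: "'d \<Rightarrow>\<^sub>0 'k"
  proof -
    have "vcoset ?F kernel (n + m - 1) (bilin c i x y) = fiber (n + m - 1) (bilin c' i q q')"
      if "x \<in> fiber n q" "y \<in> fiber m q'" for x y
      using vcoset_kernel[OF bilin_closed[OF fiberD(1)[OF that(1)] fiberD(1)[OF that(2)] i]]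
        push_bilin[OF fiberD(1)[OF that(1)] fiberD(1)[OF that(2)] i]
        fiberD(2)[OF that(1)] fiberD(2)[OF that(2)]
      by simp
    then show ?thesis using ne[OF that(1)] ne[OF that(2)] by simp
  qed
  have unit: "fiber 1 (bvec (f e)) = vcoset ?F kernel 1 (bvec e)"
    using vcoset_kernel[of "bvec e :: 'b \<Rightarrow>\<^sub>0 'k" 1] unit_closed by simp
  show ?thesis
    unfolding operad_iso_def
  proof (intro exI[of _ fiber] conjI allI ballI)
    fix n m i q q'
    assume "i \<in> {1..n}" "q \<in> comp ?O n" "q' \<in> comp ?O m"
    then show "fiber (n + m - 1) (pcomp ?O n m i q q') =
        pcomp (quotient_operad ?F kernel) n m i (fiber n q) (fiber m q')"
      using pcomp[of q n q' m i] by (simp only: quotient_operad_def operad.simps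
          linear_operad_simps linear_operad_pcomp)
  next
    show "fiber 1 (opunit ?O) = opunit (quotient_operad ?F kernel)"
      using unit by (simp add: quotient_operad_def)
  qed (use bij in \<open>simp_all add: add scale quotient_operad_def\<close>)
qed

text \<open>It suffices that basis elements with equal image are congruent modulo every ideal
  containing \<open>R\<close>. Choosing a representative for each image and replacing every basis
  element by its representative changes \<open>p\<close> only by elements of the ideal; for
  \<open>p\<close> in the kernel the result of the replacement is 0.\<close>

lemma generated_ideal_eq_kernel:
  assumes R: "\<And>n. R n \<subseteq> kernel n"
    and gen: "\<And>I n u v. operad_ideal (linear_operad B c e) I \<Longrightarrow> (\<And>m. R m \<subseteq> I m) \<Longrightarrow>
      u \<in> B n \<Longrightarrow> v \<in> B n \<Longrightarrow> f u = f v \<Longrightarrow> bvec u - bvec v \<in> I n"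
  shows "generated_ideal (linear_operad B c e :: ('k::field, _) operad) R = kernel"
proof
  fix n
  have "kernel n \<subseteq> I n" if I: "operad_ideal (linear_operad B c e) I" "\<And>m. R m \<subseteq> I m"
    for I :: "nat \<Rightarrow> ('b \<Rightarrow>\<^sub>0 'k) set"
  proof
    fix p :: "'b \<Rightarrow>\<^sub>0 'k" assume p: "p \<in> kernel n"
    have sub: "pm.subspace (I n)"
      using I(1) by (auto simp: operad_ideal_def graded_subspace_iff)
    let ?g = "inv_into (B n) f"
    have "p \<in> supported (B n)"
      using p by (simp add: kernel_def)
    \<comment> \<open>This element is a linear combination of the differences of \<open>u\<close>
      and \<open>?g (f u)\<close>, to which \<open>gen\<close> applies.\<close>
    then have "p - push ?g (push f p) \<in> I n"
    proof (induction rule: supported_induct)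
      case zero
      then show ?case using pm.subspace_0[OF sub] by simp
    next
      case (single u)
      then show ?case using gen[OF I single, of "?g (f u)"]
        by (simp add: f_inv_into_f inv_into_into)
    next
      case (add p q)
      then show ?case using pm.subspace_add[OF sub] by (simp add: add_diff_add)
    next
      case (scale a p)
      then show ?case using pm.subspace_scale[OF sub, of _ a]
        by (simp flip: pm.scale_right_diff_distrib)
    qed
    then show "p \<in> I n"
      using p by (simp add: kernel_def)
  qed
  moreover have "kernel n \<in> {I n | I. operad_ideal (linear_operad B c e) I \<and> (\<forall>m. R m \<subseteq> I m)}"
    using operad_ideal_kernel R by blast
  ultimately show "generated_ideal (linear_operad B c e) R n = kernel n"
    unfolding generated_ideal_def by blast
qed

end


section \<open>Word compositions\<close>

text \<open>Isolates the letter at which a composition takes place, so that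
  \<open>word_comp_split\<close> computes the composition without index arithmetic.\<close>

lemma split_at:
  assumes "i \<in> {1..length u}"
  obtains p a q where "u = p @ a # q" "i = Suc (length p)"
proof
  show "u = take (i - 1) u @ u ! (i - 1) # drop i u"
    using assms id_take_nth_drop[of "i - 1" u] by auto
  show "i = Suc (length (take (i - 1) u))"
    using assms by auto
qed

lemma word_comp_split [simp]:
  "word_comp M (Suc (length p)) (p @ a # q) v = p @ map (\<lambda>b. a \<otimes>\<^bsub>M\<^esub> b) v @ q"
  by (simp add: word_comp_def)

lemma word_comp_append_left:
  assumes "i \<in> {1..length u}"
  shows "word_comp M i (u @ v) w = word_comp M i u w @ v"
  using assms by (auto simp: word_comp_def nth_append)

lemma word_comp_append_right:
  assumes "i > length u"
  shows "word_comp M i (u @ v) w = u @ word_comp M (i - length u) v w"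
  using assms by (auto simp: word_comp_def nth_append)

lemma length_word_comp:
  assumes "i \<in> {1..length u}"
  shows "length (word_comp M i u v) = length u + length v - 1"
proof -
  obtain p a q where "u = p @ a # q" "i = Suc (length p)"
    using split_at[OF assms] .
  then show ?thesis by simp
qed

text \<open>With \<open>u = p @ a # q\<close> and \<open>v = r @ b # s\<close>, both sides are
  \<open>p\<close>, then \<open>a\<close> times \<open>r\<close>, then \<open>a\<close> times
  \<open>b\<close> times \<open>w\<close>, then \<open>a\<close> times \<open>s\<close>, then
  \<open>q\<close>. Associativity is needed on the letters of \<open>w\<close>.\<close>

lemma (in monoid) word_comp_sequential:
  assumes "set u \<subseteq> carrier G" "set v \<subseteq> carrier G" "set w \<subseteq> carrier G"
    and "i \<in> {1..length u}" "j \<in> {1..length v}"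
  shows "word_comp G (i + j - 1) (word_comp G i u v) w = word_comp G i u (word_comp G j v w)"
proof -
  obtain p a q where u: "u = p @ a # q" "i = Suc (length p)"
    using split_at[OF assms(4)] .
  obtain r b s where v: "v = r @ b # s" "j = Suc (length r)"
    using split_at[OF assms(5)] .
  let ?p = "p @ map (\<lambda>b. a \<otimes> b) r"
  have "i + j - 1 = Suc (length ?p)"
    using u v by simp
  moreover have "word_comp G i u v = ?p @ (a \<otimes> b) # (map (\<lambda>b. a \<otimes> b) s @ q)"
    using u v by simp
  ultimately have "word_comp G (i + j - 1) (word_comp G i u v) w =
      ?p @ map (\<lambda>x. (a \<otimes> b) \<otimes> x) w @ map (\<lambda>b. a \<otimes> b) s @ q"
    by (simp only: word_comp_split)
  moreover have "map (\<lambda>x. (a \<otimes> b) \<otimes> x) w = map (\<lambda>b. a \<otimes> b) (map (\<lambda>x. b \<otimes> x) w)"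
    using assms(1-3) u v by (auto intro!: m_assoc)
  ultimately show ?thesis
    using u v by simp
qed

text \<open>Splitting \<open>u\<close> just before position \<open>j\<close> puts position
  \<open>i\<close> into the left factor, so the two compositions act on disjoint factors of
  \<open>u\<close>.\<close>

lemma word_comp_parallel:
  assumes "1 \<le> i" "i < j" "j \<le> length u"
  shows "word_comp M (j + length v - 1) (word_comp M i u v) w =
    word_comp M i (word_comp M j u w) v"
proof -
  obtain p b r where u: "u = p @ b # r" "j = Suc (length p)"
    using split_at[of j u] assms by auto
  have i: "i \<in> {1..length p}"
    using assms u by auto
  have len: "length (word_comp M i p v) = length p + length v - 1"
    by (rule length_word_comp[OF i])
  have "word_comp M i u v = word_comp M i p v @ b # r"
    using word_comp_append_left[OF i, of M "b # r" v] u by simp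
  moreover have "j + length v - 1 = Suc (length (word_comp M i p v))"
    using len u i by auto
  ultimately have "word_comp M (j + length v - 1) (word_comp M i u v) w =
      word_comp M i p v @ map (\<lambda>x. b \<otimes>\<^bsub>M\<^esub> x) w @ r"
    by (simp only: word_comp_split)
  also have "\<dots> = word_comp M i (word_comp M j u w) v"
    using u by (simp add: word_comp_append_left[OF i])
  finally show ?thesis .
qed

text \<open>Formulated for any family of words closed under composition, in order to apply to the
  words of \<open>Dias\<close> inside all words.\<close>

lemma (in monoid) basis_operad_words:
  assumes "\<And>n. W n \<subseteq> words G n" "[\<one>] \<in> W 1"
    and "\<And>n m i u v. u \<in> W n \<Longrightarrow> v \<in> W m \<Longrightarrow> i \<in> {1..n} \<Longrightarrow> word_comp G i u v \<in> W (n + m - 1)"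
  shows "basis_operad W (word_comp G) [\<one>]"
proof -
  have W: "length u = n" "set u \<subseteq> carrier G" if "u \<in> W n" for u n
    using assms(1)[of n] that by (auto simp: words_def)
  show ?thesis
  proof
    fix n u assume "u \<in> W n"
    then show "word_comp G 1 [\<one>] u = u"
      using W(2)[of u n] by (auto simp: word_comp_def intro!: map_idI l_one)
  next
    fix n i u assume "u \<in> W n" "i \<in> {1..n}"
    then have "i \<in> {1..length u}" and carr: "set u \<subseteq> carrier G"
      using W by auto
    then obtain p a q where "u = p @ a # q" "i = Suc (length p)"
      using split_at by blast
    then show "word_comp G i u [\<one>] = u"
      using carr by simp
  next
    fix n m l i j u v w
    assume "u \<in> W n" "v \<in> W m" "w \<in> W l" "i \<in> {1..n}" "j \<in> {1..m}"
    then show "word_comp G (i + j - 1) (word_comp G i u v) w = word_comp G i u (word_comp G j v w)"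
      using W by (intro word_comp_sequential) auto
  next
    fix n m l i j u v w
    assume "u \<in> W n" "v \<in> W m" "w \<in> W l" "1 \<le> i" "i < j" "j \<le> n"
    then show "word_comp G (j + m - 1) (word_comp G i u v) w = word_comp G i (word_comp G j u w) v"
      using W word_comp_parallel[of i j u G v w] by auto
  qed (use assms in auto)
qed


section \<open>Evaluation of trees in the pluriassociative operad\<close>

abbreviation dias_tree :: "nat \<Rightarrow> dias_gen tree \<Rightarrow> bool" where
  "dias_tree \<gamma> \<equiv> wf_tree (dias_gens \<gamma>) dias_ar"

text \<open>The evaluation that reads \<open>Dashv a\<close> as \<open>[0, a]\<close> and
  \<open>Vdash a\<close> as \<open>[a, 0]\<close>; the side with letter 0 stays unchanged because
  \<open>max 0\<close> is the identity. The default \<open>[]\<close> concerns only nodes without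
  exactly two children, which are not well-formed.\<close>

fun dias_word :: "dias_gen tree \<Rightarrow> nat list" where
  "dias_word Leaf = [0]"
| "dias_word (Node (Dashv a) [s, t]) = dias_word s @ map (max a) (dias_word t)"
| "dias_word (Node (Vdash a) [s, t]) = map (max a) (dias_word s) @ dias_word t"
| "dias_word _ = []"

text \<open>Taking the image makes the evaluation surjective by construction;
  \<open>Dias_eq_linear_operad\<close> shows that these words do span \<open>Dias\<close>.\<close>

definition dias_basis :: "nat \<Rightarrow> nat \<Rightarrow> nat list set" where
  "dias_basis \<gamma> n = dias_word ` trees (dias_gens \<gamma>) dias_ar n"

lemma dias_gens_iff [simp]:
  "Dashv a \<in> dias_gens \<gamma> \<longleftrightarrow> a \<in> {1..\<gamma>}"
  "Vdash a \<in> dias_gens \<gamma> \<longleftrightarrow> a \<in> {1..\<gamma>}"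
  by (auto simp: dias_gens_def)

lemma eq_dias_ar [simp]: "Suc (Suc 0) = dias_ar x" "dias_ar x = dias_ar y"
  by (simp_all add: dias_ar_def)

lemma dias_tree_binary_induct [consumes 1, case_names Leaf Dashv Vdash]:
  assumes "dias_tree \<gamma> t"
    and "P Leaf"
    and "\<And>a s t. a \<in> {1..\<gamma>} \<Longrightarrow> dias_tree \<gamma> s \<Longrightarrow> dias_tree \<gamma> t \<Longrightarrow> P s \<Longrightarrow> P t \<Longrightarrow>
      P (Node (Dashv a) [s, t])"
    and "\<And>a s t. a \<in> {1..\<gamma>} \<Longrightarrow> dias_tree \<gamma> s \<Longrightarrow> dias_tree \<gamma> t \<Longrightarrow> P s \<Longrightarrow> P t \<Longrightarrow>
      P (Node (Vdash a) [s, t])"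
  shows "P t"
  using assms(1)
proof (induction t)
  case Leaf
  show ?case by (rule assms(2))
next
  case (Node x ts)
  then have "length ts = 2"
    by (simp add: dias_ar_def)
  then obtain s t where ts: "ts = [s, t]"
    by (auto simp: numeral_2_eq_2 length_Suc_conv)
  with Node have "x \<in> dias_gens \<gamma>" "dias_tree \<gamma> s" "dias_tree \<gamma> t" "P s" "P t"
    by auto
  then show ?case
    unfolding ts by (cases x) (auto intro: assms(3,4))
qed

lemma leaves_pos: "dias_tree \<gamma> t \<Longrightarrow> leaves t \<ge> 1"
  by (induction rule: dias_tree_binary_induct) auto

lemma dias_tree_graft:
  "dias_tree \<gamma> s \<Longrightarrow> dias_tree \<gamma> t \<Longrightarrow> dias_tree \<gamma> (graft i s t)"
  by (induction arbitrary: i rule: dias_tree_binary_induct) auto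

lemma leaves_graft:
  "dias_tree \<gamma> s \<Longrightarrow> dias_tree \<gamma> t \<Longrightarrow> i \<in> {1..leaves s} \<Longrightarrow>
    leaves (graft i s t) = leaves s + leaves t - 1"
proof (induction arbitrary: i rule: dias_tree_binary_induct)
  case Leaf
  then show ?case by simp
next
  case (Dashv a s1 s2)
  then show ?case
    using leaves_pos[OF Dashv.hyps(2)] leaves_pos[OF Dashv.hyps(3)] by auto
next
  case (Vdash a s1 s2)
  then show ?case
    using leaves_pos[OF Vdash.hyps(2)] leaves_pos[OF Vdash.hyps(3)] by auto
qed

lemma length_dias_word: "dias_tree \<gamma> t \<Longrightarrow> length (dias_word t) = leaves t"
  by (induction rule: dias_tree_binary_induct) auto

lemma set_dias_word: "dias_tree \<gamma> t \<Longrightarrow> set (dias_word t) \<subseteq> {0..\<gamma>}"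
  by (induction rule: dias_tree_binary_induct) auto

lemma word_comp_map_max:
  assumes "i \<in> {1..length u}"
  shows "word_comp (max_monoid \<gamma>) i (map (max a) u) v = map (max a) (word_comp (max_monoid \<gamma>) i u v)"
  using assms by (auto simp: word_comp_def max_monoid_def take_map drop_map max.assoc)

text \<open>The chosen leaf lies in one of the two subtrees, and the word of a node is a
  concatenation, so the composition takes place in one factor. If that factor is raised by
  \<open>max a\<close>, the raising commutes with the composition by
  \<open>word_comp_map_max\<close>.\<close>

lemma dias_word_graft:
  "dias_tree \<gamma> s \<Longrightarrow> dias_tree \<gamma> t \<Longrightarrow> i \<in> {1..leaves s} \<Longrightarrow>
    dias_word (graft i s t) = word_comp (max_monoid \<gamma>) i (dias_word s) (dias_word t)"
proof (induction arbitrary: i rule: dias_tree_binary_induct)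
  case Leaf
  then show ?case by (simp add: word_comp_def max_monoid_def)
next
  case (Dashv a s1 s2)
  then show ?case
    by (cases "i \<le> leaves s1")
      (auto simp: word_comp_append_left word_comp_append_right word_comp_map_max length_dias_word)
next
  case (Vdash a s1 s2)
  then show ?case
    by (cases "i \<le> leaves s1")
      (auto simp: word_comp_append_left word_comp_append_right word_comp_map_max length_dias_word)
qed

lemma trees_graft:
  assumes "s \<in> trees (dias_gens \<gamma>) dias_ar n" "t \<in> trees (dias_gens \<gamma>) dias_ar m" "i \<in> {1..n}"
  shows "graft i s t \<in> trees (dias_gens \<gamma>) dias_ar (n + m - 1)"
  using assms dias_tree_graft leaves_graft by (auto simp: trees_def)

interpretation dias: basis_surjection "trees (dias_gens \<gamma>) dias_ar" graft Leaf
  "dias_basis \<gamma>" "word_comp (max_monoid \<gamma>)" dias_word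
  for \<gamma>
proof
  fix n m i s t
  assume "s \<in> trees (dias_gens \<gamma>) dias_ar n" "t \<in> trees (dias_gens \<gamma>) dias_ar m" "i \<in> {1..n}"
  then show "dias_word (graft i s t) = word_comp (max_monoid \<gamma>) i (dias_word s) (dias_word t)"
    by (auto simp: trees_def intro: dias_word_graft)
qed (use trees_graft in \<open>simp_all add: dias_basis_def trees_def\<close>)

lemma dias_basis_words: "dias_basis \<gamma> n \<subseteq> words (max_monoid \<gamma>) n"
  using leaves_pos[of \<gamma>] set_dias_word[of \<gamma>]
  by (auto simp: dias_basis_def trees_def words_def max_monoid_def length_dias_word subset_iff)

lemma basis_operad_dias: "basis_operad (dias_basis \<gamma>) (word_comp (max_monoid \<gamma>)) [0]"
proof -
  interpret monoid "max_monoid \<gamma>" by (rule monoid_max_monoid)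
  have "basis_operad (dias_basis \<gamma>) (word_comp (max_monoid \<gamma>)) [\<one>\<^bsub>max_monoid \<gamma>\<^esub>]"
  proof (rule basis_operad_words)
    show "dias_basis \<gamma> n \<subseteq> words (max_monoid \<gamma>) n" for n
      by (rule dias_basis_words)
    show "[\<one>\<^bsub>max_monoid \<gamma>\<^esub>] \<in> dias_basis \<gamma> 1"
      by (auto simp: dias_basis_def trees_def max_monoid_def intro!: image_eqI[of _ _ Leaf])
    show "word_comp (max_monoid \<gamma>) i u v \<in> dias_basis \<gamma> (n + m - 1)"
      if u: "u \<in> dias_basis \<gamma> n" and v: "v \<in> dias_basis \<gamma> m" and i: "i \<in> {1..n}" for n m i u v
    proof -
      obtain s t where s: "s \<in> trees (dias_gens \<gamma>) dias_ar n" "u = dias_word s"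
        and t: "t \<in> trees (dias_gens \<gamma>) dias_ar m" "v = dias_word t"
        using u v by (auto simp: dias_basis_def)
      show ?thesis
        unfolding s(2) t(2) dias.hom[OF s(1) t(1) i, symmetric] dias_basis_def
        by (rule imageI) (rule dias.closed[OF s(1) t(1) i])
    qed
  qed
  then show ?thesis by (simp add: max_monoid_def)
qed

text \<open>The span of the words of trees is a suboperad containing the generators. Conversely, a
  suboperad containing the generators contains the word of every tree, by induction on the
  tree.\<close>

lemma Dias_eq_linear_operad:
  "Dias \<gamma> = (linear_operad (dias_basis \<gamma>) (word_comp (max_monoid \<gamma>)) [0] ::
    ('k::field, _) operad)"
proof -
  interpret monoid "max_monoid \<gamma>" by (rule monoid_max_monoid)
  interpret D: basis_operad "dias_basis \<gamma>" "word_comp (max_monoid \<gamma>)" "[0]"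
    by (rule basis_operad_dias)
  let ?T = "T_operad (max_monoid \<gamma>) :: ('k, nat list \<Rightarrow>\<^sub>0 'k) operad"
  let ?S = "\<lambda>n. supported (dias_basis \<gamma> n) :: (nat list \<Rightarrow>\<^sub>0 'k) set"
  have T [simp]: "comp ?T n = supported (words (max_monoid \<gamma>) n)" "vadd ?T n = (+)"
    "vzero ?T n = 0" "vscale ?T n = pm_scale" "opunit ?T = bvec [0]"
    "pcomp ?T n m i = bilin (word_comp (max_monoid \<gamma>)) i" for n m i
    by (simp_all add: T_operad_def max_monoid_def)
  have sub: "suboperad ?T ?S"
    unfolding suboperad_def graded_subspace_def
  proof (intro conjI allI ballI)
    show "?S n \<subseteq> comp ?T n" for n
      using dias_basis_words by (force simp: supported_def)
    show "pcomp ?T n m i x y \<in> ?S (n + m - 1)"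
      if "i \<in> {1..n}" "x \<in> ?S n" "y \<in> ?S m" for n m i x y
      using that D.closed by (auto intro!: bilin_supported[of x "dias_basis \<gamma> n" y "dias_basis \<gamma> m"])
  qed (use D.unit_closed in auto)
  have gens: "dias_words \<gamma> m \<subseteq> ?S m" for m
  proof
    fix x :: "nat list \<Rightarrow>\<^sub>0 'k" assume "x \<in> dias_words \<gamma> m"
    then obtain w a where x: "x = bvec w" "m = 2" "a \<in> {1..\<gamma>}" "w = [0, a] \<or> w = [a, 0]"
      by (auto simp: dias_words_def split: if_splits)
    then have "w = dias_word (Node (Dashv a) [Leaf, Leaf]) \<or> w = dias_word (Node (Vdash a) [Leaf, Leaf])"
      by simp
    moreover have "Node (Dashv a) [Leaf, Leaf] \<in> trees (dias_gens \<gamma>) dias_ar 2"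
      "Node (Vdash a) [Leaf, Leaf] \<in> trees (dias_gens \<gamma>) dias_ar 2"
      using x(3) by (simp_all add: trees_def)
    ultimately show "x \<in> ?S m"
      using x(1,2) unfolding dias_basis_def by blast
  qed
  have least: "?S n \<subseteq> P n" if P: "suboperad ?T P" "\<forall>m. dias_words \<gamma> m \<subseteq> P m" for P n
  proof
    have closed: "bvec (word_comp (max_monoid \<gamma>) i u v) \<in> P (n + m - 1)"
      if "bvec u \<in> P n" "bvec v \<in> P m" "i \<in> {1..n}" for u v n m i
      using P(1) that unfolding suboperad_def by (metis T(6) bilin_simps(9))
    have sub: "0 \<in> P n" "p + q \<in> P n" "pm_scale a p \<in> P n"
      if "p \<in> P n" "q \<in> P n" for p q a n
      using P(1) that by (auto simp: suboperad_def graded_subspace_def)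
    have zero: "0 \<in> P n"
      using P(1) by (auto simp: suboperad_def graded_subspace_def)
    have node: "bvec (dias_word (Node x [s, t])) \<in> P (leaves (Node x [s, t]))"
      if x: "x \<in> dias_gens \<gamma>" and st: "dias_tree \<gamma> s" "dias_tree \<gamma> t"
        and IH: "bvec (dias_word s) \<in> P (leaves s)" "bvec (dias_word t) \<in> P (leaves t)"
      for x s t
    proof -
      \<comment> \<open>The node is this corolla with \<open>t\<close> grafted on leaf 2 and then
        \<open>s\<close> on leaf 1; in this order leaf 1 keeps its position.\<close>
      let ?c = "Node x [Leaf, Leaf]"
      have c: "dias_tree \<gamma> ?c"
        using x by simp
      have "bvec (dias_word ?c) \<in> dias_words \<gamma> 2"
        using x by (cases x) (auto simp: dias_words_def)
      then have "bvec (dias_word ?c) \<in> P 2"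
        using P(2) by blast
      from closed[OF this IH(2), of 2]
      have "bvec (dias_word (graft 2 ?c t)) \<in> P (leaves t + 1)"
        using dias_word_graft[OF c st(2), of 2] by simp
      from closed[OF this IH(1), of 1]
      have "bvec (dias_word (graft 1 (graft 2 ?c t) s)) \<in> P (leaves t + leaves s)"
        using dias_word_graft[OF dias_tree_graft[OF c st(2)] st(1), of 1 2]
          leaves_graft[OF c st(2), of 2] by simp
      then show ?thesis
        by (simp add: add.commute)
    qed
    have tree: "bvec (dias_word t) \<in> P (leaves t)" if "dias_tree \<gamma> t" for t
      using that
    proof (induction rule: dias_tree_binary_induct)
      case Leaf
      then show ?case using P(1) by (simp add: suboperad_def)
    qed (rule node; simp)+
    fix p :: "nat list \<Rightarrow>\<^sub>0 'k" assume "p \<in> ?S n"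
    then show "p \<in> P n"
      by (induction rule: supported_induct)
        (use tree zero sub in \<open>auto simp: dias_basis_def trees_def\<close>)
  qed
  have "\<Inter>{P n |P. suboperad ?T P \<and> (\<forall>m. dias_words \<gamma> m \<subseteq> P m)} = ?S n" for n
    using sub gens least[of _ n] by blast
  then show ?thesis
    unfolding Dias_def generated_suboperad_def
    by (simp add: T_operad_def linear_operad_def supported_def max_monoid_def fun_eq_iff)
qed


section \<open>Rewriting trees modulo the relations\<close>

abbreviation dias_relations :: "nat \<Rightarrow> nat \<Rightarrow> (dias_gen tree \<Rightarrow>\<^sub>0 'k::field) set" where
  "dias_relations \<gamma> \<equiv> induced_space (dias_gens \<gamma>) dias_ar (dias_equiv \<gamma>)"

text \<open>The normal form of a tree whose word is \<open>u @ 0 # v\<close>, with no 0 in \<open>u\<close> and \<open>v\<close>, is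
  \<open>prepend_letters u (append_letters Leaf v)\<close>.\<close>

definition append_letters :: "dias_gen tree \<Rightarrow> nat list \<Rightarrow> dias_gen tree" where
  "append_letters t v = foldl (\<lambda>t a. Node (Dashv a) [t, Leaf]) t v"

definition prepend_letters :: "nat list \<Rightarrow> dias_gen tree \<Rightarrow> dias_gen tree" where
  "prepend_letters u t = foldr (\<lambda>a t. Node (Vdash a) [Leaf, t]) u t"

text \<open>\<open>I\<close> is an arbitrary ideal containing the relations, since
  \<open>generated_ideal_eq_kernel\<close> asks for congruences modulo each of them.\<close>

locale dias_ideal =
  fixes \<gamma> :: nat and I :: "nat \<Rightarrow> (dias_gen tree \<Rightarrow>\<^sub>0 'k::field) set"
  assumes ideal: "operad_ideal (free_operad (dias_gens \<gamma>) dias_ar) I"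
    and relations: "dias_relations \<gamma> n \<subseteq> I n"
begin

text \<open>Well-formedness and equal arity are built in, so that they propagate along chains of
  congruences.\<close>

definition eqv :: "dias_gen tree \<Rightarrow> dias_gen tree \<Rightarrow> bool" (infix "\<approx>" 50) where
  "s \<approx> t \<longleftrightarrow> dias_tree \<gamma> s \<and> dias_tree \<gamma> t \<and> leaves s = leaves t \<and>
     bvec s - bvec t \<in> I (leaves s)"

lemma subspace_ideal: "pm.subspace (I n)"
  using ideal by (simp add: operad_ideal_def free_operad_def dias.graded_subspace_iff)

lemma eqvD: "s \<approx> t \<Longrightarrow> dias_tree \<gamma> s" "s \<approx> t \<Longrightarrow> dias_tree \<gamma> t"
  by (simp_all add: eqv_def)

lemma eqv_refl: "dias_tree \<gamma> t \<Longrightarrow> t \<approx> t"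
  using pm.subspace_0[OF subspace_ideal] by (simp add: eqv_def)

lemma eqv_sym: "s \<approx> t \<Longrightarrow> t \<approx> s"
  using pm.subspace_neg[OF subspace_ideal, of "bvec s - bvec t" "leaves s"] by (auto simp: eqv_def)

lemma eqv_trans [trans]: "s \<approx> t \<Longrightarrow> t \<approx> u \<Longrightarrow> s \<approx> u"
  using pm.subspace_add[OF subspace_ideal, of "bvec s - bvec t" "leaves s" "bvec t - bvec u"]
  by (auto simp: eqv_def)

text \<open>Composing the difference of \<open>s\<close> and \<open>s'\<close> with \<open>t\<close>
  stays in the ideal, and by bilinearity the result is the difference of the two grafted
  trees.\<close>

lemma eqv_graft_left:
  assumes "s \<approx> s'" "dias_tree \<gamma> t" "i \<in> {1..leaves s}"
  shows "graft i s t \<approx> graft i s' t"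
proof -
  have "bvec t \<in> supported (trees (dias_gens \<gamma>) dias_ar (leaves t))"
    using assms(2) by (intro supported_intros) (simp add: trees_def)
  then have "bilin graft i (bvec s - bvec s') (bvec t) \<in> I (leaves s + leaves t - 1)"
    using assms ideal unfolding operad_ideal_def eqv_def free_operad_def linear_operad_simps
      linear_operad_pcomp by blast
  then show ?thesis
    using assms by (auto simp: eqv_def dias_tree_graft leaves_graft)
qed

lemma eqv_graft_right:
  assumes "dias_tree \<gamma> s" "t \<approx> t'" "i \<in> {1..leaves s}"
  shows "graft i s t \<approx> graft i s t'"
proof -
  have "bvec s \<in> supported (trees (dias_gens \<gamma>) dias_ar (leaves s))"
    using assms(1) by (intro supported_intros) (simp add: trees_def)
  then have "bilin graft i (bvec s) (bvec t - bvec t') \<in> I (leaves s + leaves t - 1)"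
    using assms ideal unfolding operad_ideal_def eqv_def free_operad_def linear_operad_simps
      linear_operad_pcomp by blast
  then show ?thesis
    using assms by (auto simp: eqv_def dias_tree_graft leaves_graft)
qed

lemma eqv_node:
  assumes x: "x \<in> dias_gens \<gamma>" and st: "s \<approx> s'" "t \<approx> t'"
  shows "Node x [s, t] \<approx> Node x [s', t']"
proof -
  have c: "dias_tree \<gamma> (Node x [Leaf, u])" if "dias_tree \<gamma> u" for u
    using x that by simp
  have "graft 1 (Node x [Leaf, t]) s \<approx> graft 1 (Node x [Leaf, t]) s'"
    using c st(1) eqvD[OF st(2)] by (intro eqv_graft_right) auto
  moreover have "graft 2 (Node x [Leaf, Leaf]) t \<approx> graft 2 (Node x [Leaf, Leaf]) t'"
    using x st(2) by (intro eqv_graft_right) auto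
  then have "graft 1 (graft 2 (Node x [Leaf, Leaf]) t) s'
      \<approx> graft 1 (graft 2 (Node x [Leaf, Leaf]) t') s'"
    using eqvD[OF st(1)] by (intro eqv_graft_left) auto
  ultimately show ?thesis
    using eqv_trans by simp
qed

text \<open>A relation between trees with three leaves is instantiated with arbitrary subtrees. The
  leaves are filled from right to left, so the positions still to be filled do not move.\<close>

lemma eqv_relation:
  assumes rel: "dias_equiv \<gamma> T T'"
    and TT': "dias_tree \<gamma> T" "dias_tree \<gamma> T'" "leaves T = 3" "leaves T' = 3"
    and stu: "dias_tree \<gamma> s" "dias_tree \<gamma> t" "dias_tree \<gamma> u"
  shows "graft 1 (graft 2 (graft 3 T u) t) s \<approx> graft 1 (graft 2 (graft 3 T' u) t) s"
proof -
  have "bvec T - bvec T' \<in> dias_relations \<gamma> 3"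
    unfolding induced_space_def using rel TT' by (intro pm.span_base) (auto simp: trees_def)
  then have "T \<approx> T'"
    using TT' relations by (auto simp: eqv_def)
  then have "graft 3 T u \<approx> graft 3 T' u"
    using TT' stu by (intro eqv_graft_left) auto
  then have "graft 2 (graft 3 T u) t \<approx> graft 2 (graft 3 T' u) t"
    using TT' stu leaves_graft[of \<gamma> T u 3] by - (rule eqv_graft_left; auto)
  moreover have "leaves (graft 2 (graft 3 T u) t) \<ge> 1"
    using TT' stu by (intro leaves_pos[of \<gamma>] dias_tree_graft)
  ultimately show ?thesis
    using stu by - (rule eqv_graft_left; auto)
qed

section \<open>The relations as rotations of two adjacent nodes with arbitrary subtrees\<close>

lemma eqv_right_left:
  assumes "dias_equiv \<gamma> (x \<circ>[2] y) (z \<circ>[1] w)"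
    and "{x, y, z, w} \<subseteq> dias_gens \<gamma>" "dias_tree \<gamma> s" "dias_tree \<gamma> t" "dias_tree \<gamma> u"
  shows "Node x [s, Node y [t, u]] \<approx> Node z [Node w [s, t], u]"
  using eqv_relation[OF assms(1) _ _ _ _ assms(3-5)] assms(2-5)
  unfolding gen_comp_1 gen_comp_2 by simp

lemma dias_equiv_base: "dias_rel \<gamma> x y \<Longrightarrow> dias_equiv \<gamma> x y"
  unfolding dias_equiv_def by (rule r_into_equivclp)

lemma dias_equiv_sym: "dias_equiv \<gamma> x y \<Longrightarrow> dias_equiv \<gamma> y x"
  unfolding dias_equiv_def by (rule equivclp_sym)

lemma dias_equiv_trans: "dias_equiv \<gamma> x y \<Longrightarrow> dias_equiv \<gamma> y z \<Longrightarrow> dias_equiv \<gamma> x z"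
  unfolding dias_equiv_def by (rule equivclp_trans)

lemma eqv_commute:
  assumes "a \<in> {1..\<gamma>}" "b \<in> {1..\<gamma>}" "dias_tree \<gamma> s" "dias_tree \<gamma> t" "dias_tree \<gamma> u"
  shows "Node (Dashv a) [Node (Vdash b) [s, t], u] \<approx> Node (Vdash b) [s, Node (Dashv a) [t, u]]"
  using assms dias_rel.intros(1)[OF assms(1,2)]
  by (intro eqv_sym[OF eqv_right_left] dias_equiv_sym[OF dias_equiv_base]) auto

text \<open>Expressing the new label by \<open>max\<close> merges the relations for
  \<open>a < b\<close> with those for \<open>b \<le> a\<close> into a single rule; the same is done
  in the three lemmas that follow.\<close>

lemma eqv_dashv_dashv:
  assumes "a \<in> {1..\<gamma>}" "b \<in> {1..\<gamma>}" "dias_tree \<gamma> s" "dias_tree \<gamma> t" "dias_tree \<gamma> u"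
  shows "Node (Dashv a) [s, Node (Dashv b) [t, u]] \<approx> Node (Dashv (max a b)) [Node (Dashv a) [s, t], u]"
proof (rule eqv_right_left)
  show "dias_equiv \<gamma> (Dashv a \<circ>[2] Dashv b) (Dashv (max a b) \<circ>[1] Dashv a)"
  proof (cases "a < b")
    case True
    then show ?thesis
      using dias_rel.intros(4)[OF assms(1,2)] by (auto simp: max_def intro: dias_equiv_sym dias_equiv_base)
  next
    case False
    then show ?thesis
      using dias_rel.intros(6)[OF assms(2,1)] by (auto simp: max_def intro: dias_equiv_sym dias_equiv_base)
  qed
qed (use assms in auto)

lemma eqv_dashv_vdash:
  assumes "a \<in> {1..\<gamma>}" "b \<in> {1..\<gamma>}" "dias_tree \<gamma> s" "dias_tree \<gamma> t" "dias_tree \<gamma> u"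
  shows "Node (Dashv a) [s, Node (Vdash b) [t, u]] \<approx> Node (Dashv a) [Node (Dashv (max a b)) [s, t], u]"
proof (rule eqv_right_left)
  show "dias_equiv \<gamma> (Dashv a \<circ>[2] Vdash b) (Dashv a \<circ>[1] Dashv (max a b))"
  proof (cases "a < b")
    case True
    then show ?thesis
      using dias_rel.intros(2)[OF assms(1,2)] by (auto simp: max_def intro: dias_equiv_sym dias_equiv_base)
  next
    case False
    then have "b \<le> a" by simp
    \<comment> \<open>The listed pairs connect the two trees through
      \<open>Dashv a \<circ>[2] Dashv b\<close>.\<close>
    with False show ?thesis
      using dias_equiv_trans[OF dias_equiv_base[OF dias_rel.intros(6)[OF assms(2,1)]]
          dias_equiv_base[OF dias_rel.intros(7)[OF assms(2,1)]]]
      by (auto simp: max_def intro: dias_equiv_sym)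
  qed
qed (use assms in auto)

lemma eqv_vdash_dashv:
  assumes "a \<in> {1..\<gamma>}" "b \<in> {1..\<gamma>}" "dias_tree \<gamma> s" "dias_tree \<gamma> t" "dias_tree \<gamma> u"
  shows "Node (Vdash a) [Node (Dashv b) [s, t], u] \<approx> Node (Vdash a) [s, Node (Vdash (max a b)) [t, u]]"
proof (rule eqv_sym[OF eqv_right_left])
  show "dias_equiv \<gamma> (Vdash a \<circ>[2] Vdash (max a b)) (Vdash a \<circ>[1] Dashv b)"
  proof (cases "a < b")
    case True
    then show ?thesis
      using dias_rel.intros(3)[OF assms(1,2)] by (auto simp: max_def intro: dias_equiv_sym dias_equiv_base)
  next
    case False
    then have "b \<le> a" by simp
    \<comment> \<open>The listed pairs connect the two trees through
      \<open>Vdash a \<circ>[1] Vdash b\<close>.\<close>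
    with False show ?thesis
      using dias_equiv_trans[OF dias_equiv_base[OF dias_rel.intros(8)[OF assms(2,1)]]
          dias_equiv_base[OF dias_rel.intros(9)[OF assms(2,1)]]]
      by (auto simp: max_def intro: dias_equiv_sym)
  qed
qed (use assms in auto)

lemma eqv_vdash_vdash:
  assumes "a \<in> {1..\<gamma>}" "b \<in> {1..\<gamma>}" "dias_tree \<gamma> s" "dias_tree \<gamma> t" "dias_tree \<gamma> u"
  shows "Node (Vdash a) [Node (Vdash b) [s, t], u] \<approx> Node (Vdash (max a b)) [s, Node (Vdash a) [t, u]]"
proof (rule eqv_sym[OF eqv_right_left])
  show "dias_equiv \<gamma> (Vdash (max a b) \<circ>[2] Vdash a) (Vdash a \<circ>[1] Vdash b)"
  proof (cases "a < b")
    case True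
    then show ?thesis
      using dias_rel.intros(5)[OF assms(1,2)] by (auto simp: max_def intro: dias_equiv_sym dias_equiv_base)
  next
    case False
    then show ?thesis
      using dias_rel.intros(9)[OF assms(2,1)] by (auto simp: max_def intro: dias_equiv_sym dias_equiv_base)
  qed
qed (use assms in auto)

section \<open>Reduction of trees to combs\<close>

lemma eqv_append_letters: "s \<approx> t \<Longrightarrow> set v \<subseteq> {1..\<gamma>} \<Longrightarrow> append_letters s v \<approx> append_letters t v"
proof (induction v arbitrary: s t)
  case (Cons a v)
  then have "Node (Dashv a) [s, Leaf] \<approx> Node (Dashv a) [t, Leaf]"
    by (intro eqv_node eqv_refl) auto
  from Cons.IH[OF this] Cons.prems show ?case
    by (simp add: append_letters_def)
qed (simp add: append_letters_def)

lemma eqv_prepend_letters: "s \<approx> t \<Longrightarrow> set u \<subseteq> {1..\<gamma>} \<Longrightarrow> prepend_letters u s \<approx> prepend_letters u t"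
  unfolding prepend_letters_def by (induction u) (auto intro!: eqv_node eqv_refl)

text \<open>Since \<open>\<approx>\<close> includes well-formedness, this is the reflexive case of
  the congruence lemma.\<close>

lemma dias_tree_append_letters: "dias_tree \<gamma> t \<Longrightarrow> set v \<subseteq> {1..\<gamma>} \<Longrightarrow> dias_tree \<gamma> (append_letters t v)"
  using eqv_append_letters eqv_refl eqvD by blast

lemma dias_tree_prepend_letters: "dias_tree \<gamma> t \<Longrightarrow> set u \<subseteq> {1..\<gamma>} \<Longrightarrow> dias_tree \<gamma> (prepend_letters u t)"
  using eqv_prepend_letters eqv_refl eqvD by blast

lemma set_max_dias_word:
  assumes "a \<in> {1..\<gamma>}" "dias_tree \<gamma> t"
  shows "set (map (max a) (dias_word t)) \<subseteq> {1..\<gamma>}"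
  using set_dias_word[OF assms(2)] assms(1) by auto

lemma max_comp_max: "max a \<circ> max b = max (max a b)" for a b :: nat
  by (simp add: fun_eq_iff max.assoc)

text \<open>A rotation splits the right subtree \<open>t\<close> at its root and changes both the
  left argument and the label, hence the induction on \<open>t\<close> with \<open>s\<close> and
  \<open>a\<close> arbitrary. The subtree of \<open>t\<close> whose letters are raised by
  \<open>b\<close> is the one that receives the label \<open>max a b\<close>, so the letters
  agree.\<close>

lemma dashv_eqv_append_letters:
  assumes "dias_tree \<gamma> t" "dias_tree \<gamma> s" "a \<in> {1..\<gamma>}"
  shows "Node (Dashv a) [s, t] \<approx> append_letters s (map (max a) (dias_word t))"
  using assms
proof (induction arbitrary: s a rule: dias_tree_binary_induct)
  case Leaf
  then show ?case by (simp add: append_letters_def eqv_refl)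
next
  case (Dashv b t1 t2)
  have m: "max a b \<in> {1..\<gamma>}"
    using Dashv by auto
  have "Node (Dashv a) [s, Node (Dashv b) [t1, t2]]
      \<approx> Node (Dashv (max a b)) [Node (Dashv a) [s, t1], t2]"
    using Dashv by (intro eqv_dashv_dashv)
  also have "\<dots> \<approx> append_letters (Node (Dashv a) [s, t1]) (map (max (max a b)) (dias_word t2))"
    using Dashv m by (intro Dashv.IH) auto
  also have "\<dots> \<approx> append_letters (append_letters s (map (max a) (dias_word t1)))
      (map (max (max a b)) (dias_word t2))"
    using Dashv m by (intro eqv_append_letters Dashv.IH set_max_dias_word)
  also have "\<dots> = append_letters s (map (max a) (dias_word (Node (Dashv b) [t1, t2])))"
    by (simp add: append_letters_def max_comp_max)
  finally show ?case .
next
  case (Vdash b t1 t2)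
  have m: "max a b \<in> {1..\<gamma>}"
    using Vdash by auto
  have "Node (Dashv a) [s, Node (Vdash b) [t1, t2]]
      \<approx> Node (Dashv a) [Node (Dashv (max a b)) [s, t1], t2]"
    using Vdash by (intro eqv_dashv_vdash)
  also have "\<dots> \<approx> append_letters (Node (Dashv (max a b)) [s, t1]) (map (max a) (dias_word t2))"
    using Vdash m by (intro Vdash.IH) auto
  also have "\<dots> \<approx> append_letters (append_letters s (map (max (max a b)) (dias_word t1)))
      (map (max a) (dias_word t2))"
    using Vdash m by (intro eqv_append_letters Vdash.IH set_max_dias_word)
  also have "\<dots> = append_letters s (map (max a) (dias_word (Node (Vdash b) [t1, t2])))"
    by (simp add: append_letters_def max_comp_max)
  finally show ?case .
qed

text \<open>The mirror image of \<open>dashv_eqv_append_letters\<close>, by induction on the left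
  subtree.\<close>

lemma vdash_eqv_prepend_letters:
  assumes "dias_tree \<gamma> s" "dias_tree \<gamma> t" "a \<in> {1..\<gamma>}"
  shows "Node (Vdash a) [s, t] \<approx> prepend_letters (map (max a) (dias_word s)) t"
  using assms
proof (induction arbitrary: t a rule: dias_tree_binary_induct)
  case Leaf
  then show ?case by (simp add: prepend_letters_def eqv_refl)
next
  case (Dashv b s1 s2)
  have m: "max a b \<in> {1..\<gamma>}"
    using Dashv by auto
  have "Node (Vdash a) [Node (Dashv b) [s1, s2], t]
      \<approx> Node (Vdash a) [s1, Node (Vdash (max a b)) [s2, t]]"
    using Dashv by (intro eqv_vdash_dashv)
  also have "\<dots> \<approx> prepend_letters (map (max a) (dias_word s1)) (Node (Vdash (max a b)) [s2, t])"
    using Dashv m by (intro Dashv.IH) auto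
  also have "\<dots> \<approx> prepend_letters (map (max a) (dias_word s1))
      (prepend_letters (map (max (max a b)) (dias_word s2)) t)"
    using Dashv m by (intro eqv_prepend_letters Dashv.IH set_max_dias_word)
  also have "\<dots> = prepend_letters (map (max a) (dias_word (Node (Dashv b) [s1, s2]))) t"
    by (simp add: prepend_letters_def max_comp_max)
  finally show ?case .
next
  case (Vdash b s1 s2)
  have m: "max a b \<in> {1..\<gamma>}"
    using Vdash by auto
  have "Node (Vdash a) [Node (Vdash b) [s1, s2], t]
      \<approx> Node (Vdash (max a b)) [s1, Node (Vdash a) [s2, t]]"
    using Vdash by (intro eqv_vdash_vdash)
  also have "\<dots> \<approx> prepend_letters (map (max (max a b)) (dias_word s1)) (Node (Vdash a) [s2, t])"
    using Vdash m by (intro Vdash.IH) auto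
  also have "\<dots> \<approx> prepend_letters (map (max (max a b)) (dias_word s1))
      (prepend_letters (map (max a) (dias_word s2)) t)"
    using Vdash m by (intro eqv_prepend_letters Vdash.IH set_max_dias_word)
  also have "\<dots> = prepend_letters (map (max a) (dias_word (Node (Vdash b) [s1, s2]))) t"
    by (simp add: prepend_letters_def max_comp_max)
  finally show ?case .
qed

text \<open>By \<open>eqv_commute\<close>, attaching a leaf on the right passes through each
  attachment on the left.\<close>

lemma dashv_prepend_letters:
  assumes "dias_tree \<gamma> t" "set u \<subseteq> {1..\<gamma>}" "a \<in> {1..\<gamma>}"
  shows "Node (Dashv a) [prepend_letters u t, Leaf] \<approx> prepend_letters u (Node (Dashv a) [t, Leaf])"
  using assms(2)
proof (induction u)
  case Nil
  then show ?case using assms by (simp add: prepend_letters_def eqv_refl)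
next
  case (Cons b u)
  have "Node (Dashv a) [Node (Vdash b) [Leaf, prepend_letters u t], Leaf]
      \<approx> Node (Vdash b) [Leaf, Node (Dashv a) [prepend_letters u t, Leaf]]"
    using Cons.prems assms by (intro eqv_commute dias_tree_prepend_letters) auto
  also have "\<dots> \<approx> Node (Vdash b) [Leaf, prepend_letters u (Node (Dashv a) [t, Leaf])]"
    using Cons by (intro eqv_node eqv_refl) auto
  finally show ?case by (simp add: prepend_letters_def)
qed

lemma append_prepend_letters:
  assumes "dias_tree \<gamma> t" "set u \<subseteq> {1..\<gamma>}" "set v \<subseteq> {1..\<gamma>}"
  shows "append_letters (prepend_letters u t) v \<approx> prepend_letters u (append_letters t v)"
  using assms(1,3)
proof (induction v arbitrary: t)
  case Nil
  then show ?case using assms by (simp add: append_letters_def eqv_refl dias_tree_prepend_letters)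
next
  case (Cons a v)
  have "append_letters (Node (Dashv a) [prepend_letters u t, Leaf]) v
      \<approx> append_letters (prepend_letters u (Node (Dashv a) [t, Leaf])) v"
    using Cons.prems assms by (intro eqv_append_letters dashv_prepend_letters) auto
  also have "\<dots> \<approx> prepend_letters u (append_letters (Node (Dashv a) [t, Leaf]) v)"
    using Cons.prems by (intro Cons.IH) auto
  finally show ?case by (simp add: append_letters_def)
qed

text \<open>At a node labelled \<open>a\<close>, the letters of one subtree are raised to at least
  \<open>a\<close>, which is positive, so the 0 comes from the other subtree. For
  \<open>Dashv\<close> the new letters must be moved past the prepended ones; for
  \<open>Vdash\<close> they are simply prepended outermost.\<close>

lemma normal_form:
  assumes "dias_tree \<gamma> t"
  shows "\<exists>u v. dias_word t = u @ 0 # v \<and> set u \<subseteq> {1..\<gamma>} \<and> set v \<subseteq> {1..\<gamma>} \<and>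
    t \<approx> prepend_letters u (append_letters Leaf v)"
  using assms
proof (induction rule: dias_tree_binary_induct)
  case Leaf
  show ?case by (intro exI[of _ "[]"]) (simp add: append_letters_def prepend_letters_def eqv_refl)
next
  case (Dashv a s t)
  then obtain u v where s: "dias_word s = u @ 0 # v" "set u \<subseteq> {1..\<gamma>}" "set v \<subseteq> {1..\<gamma>}"
    "s \<approx> prepend_letters u (append_letters Leaf v)"
    by blast
  let ?w = "map (max a) (dias_word t)"
  have w: "set ?w \<subseteq> {1..\<gamma>}"
    using Dashv by (intro set_max_dias_word)
  have "Node (Dashv a) [s, t] \<approx> append_letters s ?w"
    using Dashv by (intro dashv_eqv_append_letters)
  also have "\<dots> \<approx> append_letters (prepend_letters u (append_letters Leaf v)) ?w"
    by (rule eqv_append_letters[OF s(4) w])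
  also have "\<dots> \<approx> prepend_letters u (append_letters (append_letters Leaf v) ?w)"
    using s w by (intro append_prepend_letters dias_tree_append_letters) auto
  also have "\<dots> = prepend_letters u (append_letters Leaf (v @ ?w))"
    by (simp add: append_letters_def)
  finally show ?case
    using s w by (intro exI[of _ u] exI[of _ "v @ ?w"]) simp
next
  case (Vdash a s t)
  then obtain u v where t: "dias_word t = u @ 0 # v" "set u \<subseteq> {1..\<gamma>}" "set v \<subseteq> {1..\<gamma>}"
    "t \<approx> prepend_letters u (append_letters Leaf v)"
    by blast
  let ?w = "map (max a) (dias_word s)"
  have w: "set ?w \<subseteq> {1..\<gamma>}"
    using Vdash by (intro set_max_dias_word)
  have "Node (Vdash a) [s, t] \<approx> prepend_letters ?w t"
    using Vdash by (intro vdash_eqv_prepend_letters)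
  also have "\<dots> \<approx> prepend_letters ?w (prepend_letters u (append_letters Leaf v))"
    by (rule eqv_prepend_letters[OF t(4) w])
  also have "\<dots> = prepend_letters (?w @ u) (append_letters Leaf v)"
    by (simp add: prepend_letters_def)
  finally show ?case
    using t w by (intro exI[of _ "?w @ u"] exI[of _ v]) simp
qed

lemma eqv_if_dias_word_eq:
  assumes "dias_tree \<gamma> s" "dias_tree \<gamma> t" "dias_word s = dias_word t"
  shows "s \<approx> t"
proof -
  obtain u v where s: "dias_word s = u @ 0 # v" "set u \<subseteq> {1..\<gamma>}" "set v \<subseteq> {1..\<gamma>}"
    "s \<approx> prepend_letters u (append_letters Leaf v)"
    using normal_form[OF assms(1)] by blast
  obtain u' v' where t: "dias_word t = u' @ 0 # v'" "set u' \<subseteq> {1..\<gamma>}" "set v' \<subseteq> {1..\<gamma>}"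
    "t \<approx> prepend_letters u' (append_letters Leaf v')"
    using normal_form[OF assms(2)] by blast
  \<comment> \<open>As 0 occurs exactly once, the word determines \<open>u\<close> and
    \<open>v\<close>, and hence the comb.\<close>
  have "0 \<notin> set u" "0 \<notin> set v"
    using s by auto
  then have "u = u'" "v = v'"
    using append_Cons_eq_iff[of 0 u v u' v'] s(1) t(1) assms(3) by auto
  with s(4) t(4) show ?thesis
    using eqv_trans eqv_sym by blast
qed

end

section \<open>Validity of the relations, and the presentation\<close>

lemma dias_rel_word: "dias_rel \<gamma> s t \<Longrightarrow> dias_word s = dias_word t"
  by (induction rule: dias_rel.induct) (simp_all only: gen_comp_1 gen_comp_2, auto)

lemma dias_equiv_word: "dias_equiv \<gamma> s t \<Longrightarrow> dias_word s = dias_word t"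
  unfolding dias_equiv_def by (induction rule: equivclp_induct) (auto dest: dias_rel_word)

text \<open>The kernel is a subspace, so only the spanning differences need to be checked, and
  related trees have the same word.\<close>

lemma dias_relations_kernel: "dias_relations \<gamma> n \<subseteq> dias.kernel \<gamma> n"
proof -
  have "pm.subspace (dias.kernel \<gamma> n)"
    using dias.operad_ideal_kernel[of \<gamma>] unfolding operad_ideal_def dias.graded_subspace_iff by blast
  then show ?thesis
    unfolding induced_space_def
    by (rule pm.span_minimal[rotated]) (auto simp: dias.kernel_def dest: dias_equiv_word)
qed

theorem theorem2p2p6:
  fixes \<gamma> :: nat
  shows "is_presentation
    (Dias \<gamma> :: ('k::field_char_0, nat list \<Rightarrow>\<^sub>0 'k) operad)
    (dias_gens \<gamma>) dias_ar
    (induced_space (dias_gens \<gamma>) dias_ar (dias_equiv \<gamma>))"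
proof -
  let ?F = "free_operad (dias_gens \<gamma>) dias_ar :: ('k, dias_gen tree \<Rightarrow>\<^sub>0 'k) operad"
  interpret D: basis_operad "dias_basis \<gamma>" "word_comp (max_monoid \<gamma>)" "[0]"
    by (rule basis_operad_dias)
  have "generated_ideal ?F (dias_relations \<gamma>) = dias.kernel \<gamma>"
    unfolding free_operad_def
  proof (rule dias.generated_ideal_eq_kernel)
    fix I :: "nat \<Rightarrow> (dias_gen tree \<Rightarrow>\<^sub>0 'k) set" and n s t
    assume I: "operad_ideal (linear_operad (trees (dias_gens \<gamma>) dias_ar) graft Leaf) I"
      "\<And>m. dias_relations \<gamma> m \<subseteq> I m"
      and st: "s \<in> trees (dias_gens \<gamma>) dias_ar n" "t \<in> trees (dias_gens \<gamma>) dias_ar n"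
      "dias_word s = dias_word t"
    interpret dias_ideal \<gamma> I
      using I by unfold_locales (simp_all add: free_operad_def)
    show "bvec s - bvec t \<in> I n"
      using eqv_if_dias_word_eq[of s t] st by (simp add: eqv_def trees_def)
  qed (rule dias_relations_kernel)
  \<comment> \<open>Being a span gives the subspace property, and lying in the kernel gives the
    supports.\<close>
  moreover have "graded_subspace ?F (dias_relations \<gamma>)"
    using dias_relations_kernel
    by (auto simp: free_operad_def dias.graded_subspace_iff induced_space_def dias.kernel_def subset_iff)
  ultimately show ?thesis
    unfolding is_presentation_def Dias_eq_linear_operad
    using D.ns_operad_linear_operad dias.operad_iso_quotient_kernel[of \<gamma>]
    by (simp add: free_operad_def)
qed

end
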